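(* Let $X,Y$ be computable metric spaces, let $Y$ be co-c.e. compact and let $A\subseteq X\times Y$ be co-c.e. closed. If $(\forall x\in X)(\exists y\in Y)\,(x,y)\in A$, then the multi-valued map $R:X\rightrightarrows Y$, $x\mapsto\{y\in Y:(x,y)\in A\}$ satisfies $R\le_W\mathsf{C_K}$.
   Context: A represented space is a pair $(X,\delta_X)$ with $\delta_X:\subseteq\mathbb N^{\mathbb N}\to X$ a partial surjection; computable metric spaces carry their Cauchy representation. For a partial multi-valued map $f:\subseteq X\rightrightarrows Y$ between represented spaces, a realizer of $f$ is a partial function $F:\subseteq\mathbb N^{\mathbb N}\to\mathbb N^{\mathbb N}$ with $\delta_Y(F(p))\in f(\delta_X(p))$ for all $p\in\mathrm{dom}(f\circ\delta_X)$. We write $f\le_W g$ (Weihrauch reducibility) if there are computable partial functions $H,K:\subseteq\mathbb N^{\mathbb N}\to\mathbb N^{\mathbb N}$ such that for every realizer $G$ of $g$ the function $p\mapsto H\langle p,G(K(p))\rangle$ is a realizer of $f$, where $\langle\cdot,\cdot\rangle$ is a standard computable pairing on $\mathbb N^{\mathbb N}$. For a computable metric space $Z$, $\mathcal A_-(Z)$ is the set of closed subsets of $Z$, where a name of $A$ is an enumeration of rational open balls (centers from the dense sequence, rational radii) whose union is $Z\setminus A$; $A$ is co-c.e. closed if it has a computable name. $Y$ is co-c.e. compact if $Y$ is compact and the set of all finite lists of rational open balls covering $Y$ is computably enumerable. $\mathsf{C_K}:\subseteq\mathcal A_-([0,1])\rightrightarrows[0,1]$, $A\mapsto A$, defined on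 non-empty closed $A\subseteq[0,1]$ (compact choice). *)

theory Defs
  imports "HOL-Analysis.Analysis" "HOL-Library.Nat_Bijection"
begin

datatype recf = Zer | Sc | Proj nat | Cmp recf "recf list" | Prim recf recf | Mn recf

inductive rec_eval :: "recf \<Rightarrow> nat list \<Rightarrow> nat \<Rightarrow> bool" where
  zer: "rec_eval Zer xs 0"
| sc: "rec_eval Sc (x # xs) (Suc x)"
| proj: "i < length xs \<Longrightarrow> rec_eval (Proj i) xs (xs ! i)"
| cmp: "length ys = length gs \<Longrightarrow> (\<forall>i < length gs. rec_eval (gs ! i) xs (ys ! i))
          \<Longrightarrow> rec_eval f ys z \<Longrightarrow> rec_eval (Cmp f gs) xs z"
| prim0: "rec_eval f xs y \<Longrightarrow> rec_eval (Prim f g) (0 # xs) y"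
| primS: "rec_eval (Prim f g) (n # xs) y \<Longrightarrow> rec_eval g (n # y # xs) z
          \<Longrightarrow> rec_eval (Prim f g) (Suc n # xs) z"
| mn: "rec_eval f (n # xs) 0 \<Longrightarrow> (\<forall>m < n. \<exists>k. rec_eval f (m # xs) (Suc k))
          \<Longrightarrow> rec_eval (Mn f) xs n"

definition computable1 :: "(nat \<Rightarrow> nat) \<Rightarrow> bool" where
  "computable1 f \<longleftrightarrow> (\<exists>r. \<forall>n. rec_eval r [n] (f n))"

definition computable2 :: "(nat \<Rightarrow> nat \<Rightarrow> nat) \<Rightarrow> bool" where
  "computable2 f \<longleftrightarrow> (\<exists>r. \<forall>n m. rec_eval r [n, m] (f n m))"

definition computable3 :: "(nat \<Rightarrow> nat \<Rightarrow> nat \<Rightarrow> nat) \<Rightarrow> bool" where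
  "computable3 f \<longleftrightarrow> (\<exists>r. \<forall>n m k. rec_eval r [n, m, k] (f n m k))"

definition ce_set :: "nat set \<Rightarrow> bool" where
  "ce_set S \<longleftrightarrow> (\<exists>r. \<forall>n. n \<in> S \<longleftrightarrow> (\<exists>y. rec_eval r [n] y))"

type_synonym baire = "nat \<Rightarrow> nat"

definition prefix_code :: "baire \<Rightarrow> nat \<Rightarrow> nat" where
  "prefix_code p k = list_encode (map p [0..<k])"

text \<open>A partial function \<open>F :\<subseteq> N^N \<rightarrow> N^N\<close> (None = undefined) is computable iff
  there is a total computable \<open>\<phi>\<close> which, given a finite prefix of the input and an
  output position n, either answers 0 (``not yet'') or Suc of the n-th output value,
  answering for every input in the domain and every n eventually, and always correctly.\<close>
definition computable_pf :: "(baire \<Rightarrow> baire option) \<Rightarrow> bool" where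
  "computable_pf F \<longleftrightarrow> (\<exists>\<phi>. computable2 \<phi> \<and>
     (\<forall>p q. F p = Some q \<longrightarrow>
        (\<forall>n. (\<exists>k. \<phi> (prefix_code p k) n = Suc (q n)) \<and>
             (\<forall>k j. \<phi> (prefix_code p k) n = Suc j \<longrightarrow> j = q n))))"

definition bpair :: "baire \<Rightarrow> baire \<Rightarrow> baire" where
  "bpair p q = (\<lambda>n. if even n then p (n div 2) else q (n div 2))"

text \<open>A representation is a partial map \<open>\<delta> :: baire \<Rightarrow> 'a option\<close>; a partial
  multi-valued map is \<open>f :: 'a \<Rightarrow> 'b set\<close> with domain {x. f x \<noteq> {}}.\<close>
definition realizer ::
  "(baire \<Rightarrow> 'a option) \<Rightarrow> (baire \<Rightarrow> 'b option) \<Rightarrow> ('a \<Rightarrow> 'b set) \<Rightarrow> (baire \<Rightarrow> baire option) \<Rightarrow> bool"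
  where
  "realizer \<delta>X \<delta>Y f F \<longleftrightarrow> (\<forall>p x. \<delta>X p = Some x \<longrightarrow> f x \<noteq> {} \<longrightarrow>
      (\<exists>q y. F p = Some q \<and> \<delta>Y q = Some y \<and> y \<in> f x))"

definition weihrauch_le ::
  "(baire \<Rightarrow> 'a option) \<Rightarrow> (baire \<Rightarrow> 'b option) \<Rightarrow> ('a \<Rightarrow> 'b set) \<Rightarrow>
   (baire \<Rightarrow> 'c option) \<Rightarrow> (baire \<Rightarrow> 'd option) \<Rightarrow> ('c \<Rightarrow> 'd set) \<Rightarrow> bool" where
  "weihrauch_le \<delta>X \<delta>Y f \<delta>Z \<delta>W g \<longleftrightarrow>
     (\<exists>H K. computable_pf H \<and> computable_pf K \<and>
        (\<forall>G. realizer \<delta>Z \<delta>W g G \<longrightarrow>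
             realizer \<delta>X \<delta>Y f
               (\<lambda>p. case K p of None \<Rightarrow> None
                    | Some k \<Rightarrow> (case G k of None \<Rightarrow> None | Some r \<Rightarrow> H (bpair p r)))))"

definition rat_dec :: "nat \<Rightarrow> real" where
  "rat_dec c = (case prod_decode c of (a, b) \<Rightarrow> real_of_int (int_decode a) / real (Suc b))"

definition comp_metric_space :: "'a set \<Rightarrow> ('a \<Rightarrow> 'a \<Rightarrow> real) \<Rightarrow> (nat \<Rightarrow> 'a) \<Rightarrow> bool" where
  "comp_metric_space M d \<alpha> \<longleftrightarrow> Metric_space M d \<and> range \<alpha> \<subseteq> M \<and>
     (\<forall>x\<in>M. \<forall>e>0. \<exists>i. d (\<alpha> i) x < e) \<and>
     (\<exists>\<phi>. computable3 \<phi> \<and>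
        (\<forall>i j n. \<bar>d (\<alpha> i) (\<alpha> j) - rat_dec (\<phi> i j n)\<bar> \<le> 1 / 2 ^ n))"

definition cauchy_limit :: "'a set \<Rightarrow> ('a \<Rightarrow> 'a \<Rightarrow> real) \<Rightarrow> (nat \<Rightarrow> 'a) \<Rightarrow> baire \<Rightarrow> 'a \<Rightarrow> bool" where
  "cauchy_limit M d \<alpha> p x \<longleftrightarrow> x \<in> M \<and>
     (\<forall>i j. i < j \<longrightarrow> d (\<alpha> (p i)) (\<alpha> (p j)) \<le> 1 / 2 ^ i) \<and>
     (\<forall>e>0. \<exists>N. \<forall>i\<ge>N. d (\<alpha> (p i)) x < e)"

definition cauchy_rep :: "'a set \<Rightarrow> ('a \<Rightarrow> 'a \<Rightarrow> real) \<Rightarrow> (nat \<Rightarrow> 'a) \<Rightarrow> baire \<Rightarrow> 'a option" where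
  "cauchy_rep M d \<alpha> p = (if \<exists>x. cauchy_limit M d \<alpha> p x
      then Some (THE x. cauchy_limit M d \<alpha> p x) else None)"

definition rball :: "'a set \<Rightarrow> ('a \<Rightarrow> 'a \<Rightarrow> real) \<Rightarrow> (nat \<Rightarrow> 'a) \<Rightarrow> nat \<Rightarrow> 'a set" where
  "rball M d \<alpha> c = (case prod_decode c of (i, r) \<Rightarrow> {x \<in> M. d (\<alpha> i) x < rat_dec r})"

text \<open>Negative information on closed sets: p enumerates balls (p n = 0: no ball,
  p n = Suc c: ball c); it names the closed set whose complement is their union.\<close>
definition enum_union :: "'a set \<Rightarrow> ('a \<Rightarrow> 'a \<Rightarrow> real) \<Rightarrow> (nat \<Rightarrow> 'a) \<Rightarrow> baire \<Rightarrow> 'a set" where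
  "enum_union M d \<alpha> p = (\<Union>n \<in> {n. p n \<noteq> 0}. rball M d \<alpha> (p n - 1))"

definition closed_neg_rep :: "'a set \<Rightarrow> ('a \<Rightarrow> 'a \<Rightarrow> real) \<Rightarrow> (nat \<Rightarrow> 'a) \<Rightarrow> baire \<Rightarrow> 'a set option" where
  "closed_neg_rep M d \<alpha> p = Some (M - enum_union M d \<alpha> p)"

definition co_ce_closed :: "'a set \<Rightarrow> ('a \<Rightarrow> 'a \<Rightarrow> real) \<Rightarrow> (nat \<Rightarrow> 'a) \<Rightarrow> 'a set \<Rightarrow> bool" where
  "co_ce_closed M d \<alpha> A \<longleftrightarrow> (\<exists>p. computable1 p \<and> closed_neg_rep M d \<alpha> p = Some A)"

definition co_ce_compact :: "'a set \<Rightarrow> ('a \<Rightarrow> 'a \<Rightarrow> real) \<Rightarrow> (nat \<Rightarrow> 'a) \<Rightarrow> bool" where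
  "co_ce_compact M d \<alpha> \<longleftrightarrow> compact_space (Metric_space.mtopology M d) \<and>
     ce_set {list_encode cs | cs. M \<subseteq> (\<Union>c \<in> set cs. rball M d \<alpha> c)}"

definition max_prod_dist :: "('a \<Rightarrow> 'a \<Rightarrow> real) \<Rightarrow> ('b \<Rightarrow> 'b \<Rightarrow> real) \<Rightarrow> 'a \<times> 'b \<Rightarrow> 'a \<times> 'b \<Rightarrow> real" where
  "max_prod_dist d1 d2 u v = max (d1 (fst u) (fst v)) (d2 (snd u) (snd v))"

definition prod_seq :: "(nat \<Rightarrow> 'a) \<Rightarrow> (nat \<Rightarrow> 'b) \<Rightarrow> nat \<Rightarrow> 'a \<times> 'b" where
  "prod_seq \<alpha>1 \<alpha>2 n = (case prod_decode n of (i, j) \<Rightarrow> (\<alpha>1 i, \<alpha>2 j))"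

definition unit_seq :: "nat \<Rightarrow> real" where
  "unit_seq n = min 1 (max 0 (rat_dec n))"

text \<open>Compact choice: C_K(A) = A on the represented space A_-([0,1]).\<close>
definition CK :: "real set \<Rightarrow> real set" where
  "CK A = A"

abbreviation delta_CK :: "baire \<Rightarrow> real set option" where
  "delta_CK \<equiv> closed_neg_rep {0..1} dist unit_seq"

abbreviation delta_R :: "baire \<Rightarrow> real option" where
  "delta_R \<equiv> cauchy_rep {0..1} dist unit_seq"

end

theory Submission
  imports Defs
begin

text \<open>Since \<open>Y\<close> is co-c.e. compact, one can compute \<open>N n\<close> such that the balls of radius \<open>2\<^sup>-\<^sup>n\<close> around
  the first \<open>N n\<close> points of the dense sequence cover \<open>Y\<close>. Every \<open>y\<close> is thus described by some \<open>s\<close> with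
  \<open>s n < N n\<close>, where \<open>s n\<close> is the index of a centre within \<open>2\<^sup>-\<^sup>n\<close> of \<open>y\<close>. That \<open>s\<close> describes
  a point of \<open>R x\<close> is a co-c.e. condition relative to a name of \<open>x\<close>: the centres have to be compatible,
  and no ball enumerated into the complement of \<open>A\<close> may be seen to contain the point. The sequences
  embed into \<open>[0, 1]\<close> as a Cantor-like set, on which the conditions cut out a non-empty closed set of which
  a negative name is computable; from any element of it, \<open>s\<close> and hence a point of \<open>R x\<close> are recovered.\<close>

section \<open>A calculus of computable functions\<close>

text \<open>A real number does not determine its digits computably: near a common endpoint of two
  digit intervals no approximation decides between them. Hence the gaps in the code, at the price
  that [0, 1] contains points coding nothing, which the negative name has to remove as well.
  Distances too are known only approximately, so each stage applies a one-sided test: it never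
  rejects a correct description, and every sequence describing no point of the fibre fails at some
  stage, since the tolerance is constant while distances are scaled by \<open>2 ^ t\<close>. A point
  may have many descriptions, which is harmless because choice has to deliver only one. As
  \<open>computable_pf\<close> asks for a total program on finite prefixes, total functions are used
  throughout; the one partial object, the enumeration of covers of \<open>Y\<close>, is made total
  by bounding evaluation steps and then searching, a search that ends by compactness.\<close>

text \<open>Computable functions of several variables are functions of an environment \<open>e\<close>, variable \<open>i\<close>
  being \<open>e i\<close>. One program has to serve all sufficiently long argument lists, so no arities occur.\<close>
definition env_comp :: "((nat \<Rightarrow> nat) \<Rightarrow> nat) \<Rightarrow> bool" where
  "env_comp F \<longleftrightarrow> (\<exists>r k. \<forall>l\<ge>k. \<forall>e. rec_eval r (map e [0..<l]) (F e))"

text \<open>Truth is coded by 0 because \<open>Mn\<close> searches for a zero.\<close>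

definition env_dec :: "((nat \<Rightarrow> nat) \<Rightarrow> bool) \<Rightarrow> bool" where
  "env_dec P \<longleftrightarrow> env_comp (\<lambda>e. if P e then 0 else 1)"

named_theorems env_intros

lemma env_comp_var [env_intros]: "env_comp (\<lambda>e. e i)"
  unfolding env_comp_def
proof (intro exI allI impI)
  fix l and e :: "nat \<Rightarrow> nat" assume "Suc i \<le> l"
  then have "i < length (map e [0..<l])" by simp
  then have "rec_eval (Proj i) (map e [0..<l]) (map e [0..<l] ! i)" by (rule rec_eval.proj)
  then show "rec_eval (Proj i) (map e [0..<l]) (e i)" using \<open>Suc i \<le> l\<close> by simp
qed

text \<open>The program for \<open>F\<close> needs only the first \<open>k\<close> variables, so
  \<open>Cmp\<close> takes finitely many of the programs for \<open>h i\<close>, and a finite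
  maximum of thresholds is a threshold. This is why computability of each \<open>h i\<close>
  separately is enough.\<close>

lemma env_comp_subst:
  assumes F: "env_comp F" and h: "\<And>i. env_comp (h i)"
  shows "env_comp (\<lambda>e. F (\<lambda>i. h i e))"
proof -
  from F obtain r k where r: "\<And>l e. l \<ge> k \<Longrightarrow> rec_eval r (map e [0..<l]) (F e)"
    unfolding env_comp_def by blast
  from h obtain R K where R: "\<And>i l e. l \<ge> K i \<Longrightarrow> rec_eval (R i) (map e [0..<l]) (h i e)"
    unfolding env_comp_def by metis
  have "rec_eval (Cmp r (map R [0..<k])) (map e [0..<l]) (F (\<lambda>i. h i e))"
    if l: "l \<ge> Max (insert 0 (K ` {..<k}))" for l e
  proof (rule rec_eval.cmp[where ys = "map (\<lambda>i. h i e) [0..<k]"])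
    have "K i \<le> l" if "i < k" for i using l that by (subst (asm) Max_le_iff) auto
    then show "\<forall>i<length (map R [0..<k]). rec_eval (map R [0..<k] ! i) (map e [0..<l]) (map (\<lambda>i. h i e) [0..<k] ! i)"
      using R by auto
  qed (use r[of k] in auto)
  then show ?thesis unfolding env_comp_def by blast
qed

lemma env_comp_zero: "env_comp (\<lambda>e. 0)"
  unfolding env_comp_def using rec_eval.zer by blast

lemma env_comp_Suc [env_intros]:
  assumes "env_comp f" shows "env_comp (\<lambda>e. Suc (f e))"
proof -
  have "env_comp (\<lambda>e. Suc (e 0))"
    unfolding env_comp_def
  proof (intro exI allI impI)
    fix l and e :: "nat \<Rightarrow> nat" assume "Suc 0 \<le> l"
    then obtain m where "l = Suc m" by (cases l) auto
    then show "rec_eval Sc (map e [0..<l]) (Suc (e 0))" by (simp only: map_upt_Suc rec_eval.sc)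
  qed
  from env_comp_subst[OF this, of "\<lambda>_. f"] assms show ?thesis by simp
qed

lemma env_comp_const [env_intros]: "env_comp (\<lambda>e. c)"
  by (induction c) (auto intro: env_comp_zero env_comp_Suc)

text \<open>In the hypothesis on \<open>b\<close>, variables 0 and 1 are the counter and the
  previous value, and the parameters are shifted by two: the order in which \<open>Prim\<close>
  hands them to its step program.\<close>

lemma env_comp_rec_nat [env_intros]:
  assumes a: "env_comp a" and b: "env_comp (\<lambda>e. b (e 0) (e (Suc 0)) (\<lambda>i. e (Suc (Suc i))))"
    and c: "env_comp c"
  shows "env_comp (\<lambda>e. rec_nat (a e) (\<lambda>n y. b n y e) (c e))"
proof -
  from a obtain ra ka where ra: "\<And>l e. l \<ge> ka \<Longrightarrow> rec_eval ra (map e [0..<l]) (a e)"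
    unfolding env_comp_def by blast
  from b obtain rb kb where rb: "\<And>l e. l \<ge> kb \<Longrightarrow>
      rec_eval rb (map e [0..<l]) (b (e 0) (e (Suc 0)) (\<lambda>i. e (Suc (Suc i))))"
    unfolding env_comp_def by blast
  define k where "k = max ka kb"
  have prim: "rec_eval (Prim ra rb) (n # map e [0..<k]) (rec_nat (a e) (\<lambda>n y. b n y e) n)" for n e
  proof (induction n)
    case 0
    then show ?case using ra[of k e] by (auto intro: rec_eval.prim0 simp: k_def)
  next
    case (Suc n)
    let ?y = "rec_nat (a e) (\<lambda>n y. b n y e) n"
    have "rec_eval rb (n # ?y # map e [0..<k]) (b n ?y e)"
      using rb[of "Suc (Suc k)" "case_nat n (case_nat ?y e)"]
      by (simp add: k_def map_upt_Suc del: upt_Suc)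
    with Suc show ?case by (auto intro: rec_eval.primS)
  qed
  \<comment> \<open>The recursion argument is first a variable of its own; \<open>c\<close> is
    substituted for it at the end. \<open>Cmp\<close> with projections cuts the arguments to the
    length \<open>Suc k\<close> that \<open>prim\<close> is about.\<close>
  have "env_comp (\<lambda>e. rec_nat (a (\<lambda>i. e (Suc i))) (\<lambda>n y. b n y (\<lambda>i. e (Suc i))) (e 0))"
    unfolding env_comp_def
  proof (intro exI allI impI)
    fix l and e :: "nat \<Rightarrow> nat" assume l: "Suc k \<le> l"
    show "rec_eval (Cmp (Prim ra rb) (map Proj [0..<Suc k])) (map e [0..<l])
       (rec_nat (a (\<lambda>i. e (Suc i))) (\<lambda>n y. b n y (\<lambda>i. e (Suc i))) (e 0))"
    proof (rule rec_eval.cmp[where ys = "map e [0..<Suc k]"])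
      have "rec_eval (Proj i) (map e [0..<l]) (e i)" if "i < Suc k" for i
        using rec_eval.proj[of i "map e [0..<l]"] that l by simp
      then show "\<forall>i<length (map Proj [0..<Suc k]).
         rec_eval (map Proj [0..<Suc k] ! i) (map e [0..<l]) (map e [0..<Suc k] ! i)"
        by (auto simp del: upt_Suc)
      show "rec_eval (Prim ra rb) (map e [0..<Suc k])
         (rec_nat (a (\<lambda>i. e (Suc i))) (\<lambda>n y. b n y (\<lambda>i. e (Suc i))) (e 0))"
        using prim by (simp only: map_upt_Suc)
    qed simp
  qed
  from env_comp_subst[OF this, of "case_nat c (\<lambda>i e. e i)"] c env_comp_var
  show ?thesis by (simp split: nat.split)
qed

lemma env_comp_subst1:
  assumes "env_comp (\<lambda>e. f (e 0))" "env_comp g"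
  shows "env_comp (\<lambda>e. f (g e))"
  using env_comp_subst[OF assms(1), of "\<lambda>_. g"] assms(2) by simp

lemma env_comp_subst2:
  assumes "env_comp (\<lambda>e. f (e 0) (e (Suc 0)))" "env_comp g" "env_comp h"
  shows "env_comp (\<lambda>e. f (g e) (h e))"
  using env_comp_subst[OF assms(1), of "case_nat g (\<lambda>_. h)"] assms(2,3) by (simp split: nat.split)

lemma env_comp_if [env_intros]:
  assumes P: "env_dec P" and f: "env_comp f" and g: "env_comp g"
  shows "env_comp (\<lambda>e. if P e then f e else g e)"
proof -
  have "env_comp (\<lambda>e. rec_nat (f e) (\<lambda>n y. g e) (if P e then 0 else 1))"
    using P g unfolding env_dec_def
    by (intro env_comp_rec_nat[where b = "\<lambda>n y e. g e"] f env_comp_subst[OF g] env_comp_var) auto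
  moreover have "rec_nat (f e) (\<lambda>n y. g e) (if P e then 0 else 1) = (if P e then f e else g e)" for e
    by simp
  ultimately show ?thesis by simp
qed

lemma env_comp_Least [env_intros]:
  assumes P: "env_dec (\<lambda>e. P (e 0) (\<lambda>i. e (Suc i)))" and ex: "\<And>e. \<exists>n. P n e"
  shows "env_comp (\<lambda>e. LEAST n. P n e)"
proof -
  from P obtain r k where r: "\<And>l e. l \<ge> k \<Longrightarrow>
      rec_eval r (map e [0..<l]) (if P (e 0) (\<lambda>i. e (Suc i)) then 0 else 1)"
    unfolding env_comp_def env_dec_def by blast
  have r': "rec_eval r (n # map e [0..<l]) (if P n e then 0 else 1)" if "l \<ge> k" for l n e
    using r[of "Suc l" "case_nat n e"] that by (simp add: map_upt_Suc del: upt_Suc)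
  have "rec_eval (Mn r) (map e [0..<l]) (LEAST n. P n e)" if "l \<ge> k" for l e
  proof (rule rec_eval.mn)
    have "P (LEAST n. P n e) e" using ex[of e] by (rule LeastI_ex)
    then show "rec_eval r ((LEAST n. P n e) # map e [0..<l]) 0"
      using r'[OF that, of "LEAST n. P n e" e] by simp
    show "\<forall>m<LEAST n. P n e. \<exists>k. rec_eval r (m # map e [0..<l]) (Suc k)"
    proof (intro allI impI exI)
      fix m assume "m < (LEAST n. P n e)"
      then have "\<not> P m e" by (rule not_less_Least)
      then show "rec_eval r (m # map e [0..<l]) (Suc 0)" using r'[OF that, of m e] by simp
    qed
  qed
  then show ?thesis unfolding env_comp_def by blast
qed

section \<open>Decidable predicates\<close>

lemma env_dec_const [env_intros]: "env_dec (\<lambda>e. b)"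
  unfolding env_dec_def by (rule env_comp_const)

lemma env_dec_eq0:
  assumes "env_comp f" shows "env_dec (\<lambda>e. f e = 0)"
proof -
  have "env_comp (\<lambda>e. rec_nat 0 (\<lambda>n y. 1) (f e))" by (intro env_intros assms)
  moreover have "rec_nat 0 (\<lambda>n y. 1) m = (if m = 0 then 0 else (1::nat))" for m by (cases m) auto
  ultimately show ?thesis by (simp only: env_dec_def)
qed

lemma env_dec_not [env_intros]:
  assumes "env_dec P" shows "env_dec (\<lambda>e. \<not> P e)"
proof -
  have "env_comp (\<lambda>e. if P e then 1 else 0)" by (intro env_intros assms)
  moreover have "(\<lambda>e. if P e then 1 else 0) = (\<lambda>e. if \<not> P e then 0 else (1::nat))" by auto
  ultimately show ?thesis by (simp only: env_dec_def)
qed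

lemma env_dec_if [env_intros]:
  assumes "env_dec P" "env_dec Q" "env_dec R"
  shows "env_dec (\<lambda>e. if P e then Q e else R e)"
proof -
  have "env_comp (\<lambda>e. if P e then if Q e then 0 else 1 else if R e then 0 else 1)"
    by (intro env_intros assms)
  moreover have "(\<lambda>e. if P e then if Q e then 0 else 1 else if R e then 0 else 1) =
     (\<lambda>e. if (if P e then Q e else R e) then 0 else (1::nat))" by auto
  ultimately show ?thesis by (simp only: env_dec_def)
qed

lemma env_dec_conj [env_intros]:
  assumes "env_dec P" "env_dec Q" shows "env_dec (\<lambda>e. P e \<and> Q e)"
  using env_dec_if[OF assms env_dec_const[of False]] by (rule back_subst[where P = env_dec]) auto

lemma env_dec_disj [env_intros]:
  assumes "env_dec P" "env_dec Q" shows "env_dec (\<lambda>e. P e \<or> Q e)"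
  using env_dec_if[OF assms(1) env_dec_const[of True] assms(2)] by (rule back_subst[where P = env_dec]) auto

lemma env_dec_imp [env_intros]:
  assumes "env_dec P" "env_dec Q" shows "env_dec (\<lambda>e. P e \<longrightarrow> Q e)"
  using env_dec_if[OF assms env_dec_const[of True]] by (rule back_subst[where P = env_dec]) auto

section \<open>Arithmetic, bounded quantifiers and pairing\<close>

lemma env_comp_add [env_intros]:
  assumes "env_comp f" "env_comp g" shows "env_comp (\<lambda>e. f e + g e)"
proof -
  have "env_comp (\<lambda>e. rec_nat (f e) (\<lambda>n y. Suc y) (g e))"
    by (intro env_intros assms)
  moreover have "rec_nat a (\<lambda>n y. Suc y) b = a + b" for a b by (induction b) auto
  ultimately show ?thesis by simp
qed

lemma env_comp_mult [env_intros]: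
  assumes "env_comp f" "env_comp g" shows "env_comp (\<lambda>e. f e * g e)"
proof (rule env_comp_subst2[OF _ assms])
  have "env_comp (\<lambda>e. rec_nat 0 (\<lambda>n y. y + e 0) (e (Suc 0)))" by (intro env_intros)
  moreover have "rec_nat 0 (\<lambda>n y. y + a) b = a * b" for a b :: nat by (induction b) auto
  ultimately show "env_comp (\<lambda>e. e 0 * e (Suc 0))" by simp
qed

lemma env_comp_power [env_intros]:
  assumes "env_comp f" "env_comp g" shows "env_comp (\<lambda>e. f e ^ g e)"
proof (rule env_comp_subst2[OF _ assms])
  have "env_comp (\<lambda>e. rec_nat 1 (\<lambda>n y. y * e 0) (e (Suc 0)))" by (intro env_intros)
  moreover have "rec_nat 1 (\<lambda>n y. y * a) b = a ^ b" for a b :: nat by (induction b) auto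
  ultimately show "env_comp (\<lambda>e. e 0 ^ e (Suc 0))" by simp
qed

lemma env_comp_diff [env_intros]:
  assumes "env_comp f" "env_comp g" shows "env_comp (\<lambda>e. f e - g e)"
proof (rule env_comp_subst2[OF _ assms])
  have "env_comp (\<lambda>e. rec_nat 0 (\<lambda>n y. n) (e 0))" by (intro env_intros)
  moreover have "rec_nat 0 (\<lambda>n y. n) a = a - 1" for a :: nat by (cases a) auto
  ultimately have pred: "env_comp (\<lambda>e. e 0 - 1)" by simp
  have "env_comp (\<lambda>e. rec_nat (e 0) (\<lambda>n y. y - 1) (e (Suc 0)))"
    by (intro env_intros env_comp_subst1[OF pred])
  moreover have "rec_nat a (\<lambda>n y. y - 1) b = a - b" for a b :: nat by (induction b) auto
  ultimately show "env_comp (\<lambda>e. e 0 - e (Suc 0))" by simp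
qed

lemma env_dec_le [env_intros]: "env_comp f \<Longrightarrow> env_comp g \<Longrightarrow> env_dec (\<lambda>e. f e \<le> g e)"
  using env_dec_eq0[OF env_comp_diff[of f g]] by simp

lemma env_dec_less [env_intros]: "env_comp f \<Longrightarrow> env_comp g \<Longrightarrow> env_dec (\<lambda>e. f e < g e)"
  using env_dec_not[OF env_dec_le[of g f]] by (simp add: not_le)

lemma env_dec_eq [env_intros]: "env_comp f \<Longrightarrow> env_comp g \<Longrightarrow> env_dec (\<lambda>e. f e = g e)"
  using env_dec_conj[OF env_dec_le[of f g] env_dec_le[of g f]] by (simp add: eq_iff)

lemma env_comp_min [env_intros]: "env_comp f \<Longrightarrow> env_comp g \<Longrightarrow> env_comp (\<lambda>e. min (f e) (g e))"
  unfolding min_def by (intro env_intros)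

text \<open>A search for a counterexample: the alternative \<open>n = b e\<close> makes it end in
  any case, and the quantifier holds iff nothing was found below the bound.\<close>

lemma env_dec_ball [env_intros]:
  assumes P: "env_dec (\<lambda>e. P (e 0) (\<lambda>i. e (Suc i)))" and b: "env_comp b"
  shows "env_dec (\<lambda>e. \<forall>n<b e. P n e)"
proof -
  have b': "env_comp (\<lambda>e. b (\<lambda>i. e (Suc i)))" using env_comp_subst[OF b] env_comp_var by simp
  have "env_dec (\<lambda>e. b e \<le> (LEAST n. n = b e \<or> \<not> P n e))"
    by (intro env_dec_le b env_comp_Least env_dec_disj env_dec_eq env_comp_var b' env_dec_not P) auto
  moreover have "b e \<le> (LEAST n. n = b e \<or> \<not> P n e) \<longleftrightarrow> (\<forall>n<b e. P n e)" for e
  proof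
    assume "b e \<le> (LEAST n. n = b e \<or> \<not> P n e)"
    then show "\<forall>n<b e. P n e" by (metis (mono_tags, lifting) not_less_Least order_less_le_trans)
  next
    assume *: "\<forall>n<b e. P n e"
    have "(LEAST n. n = b e \<or> \<not> P n e) = b e \<or> \<not> P (LEAST n. n = b e \<or> \<not> P n e) e"
      by (rule LeastI[of _ "b e"]) simp
    with * show "b e \<le> (LEAST n. n = b e \<or> \<not> P n e)"
      by (metis (no_types, lifting) le_eq_less_or_eq not_le)
  qed
  ultimately show ?thesis by simp
qed

lemma env_dec_bex [env_intros]:
  assumes "env_dec (\<lambda>e. P (e 0) (\<lambda>i. e (Suc i)))" "env_comp b"
  shows "env_dec (\<lambda>e. \<exists>n<b e. P n e)"
  using env_dec_not[OF env_dec_ball[OF env_dec_not[OF assms(1)] assms(2)]] by simp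

lemma env_comp_div [env_intros]:
  assumes "env_comp f" "env_comp g" shows "env_comp (\<lambda>e. f e div g e)"
proof (rule env_comp_subst2[OF _ assms])
  have *: "\<exists>q. b = 0 \<or> a < Suc q * b" for a b :: nat
    using dividend_less_div_times[of b a] by (cases "b = 0") (auto intro!: exI[of _ "a div b"])
  \<comment> \<open>The disjunct for divisor 0 keeps the search total; it then stops at 0, the value
    of division by 0.\<close>
  have "env_comp (\<lambda>e. LEAST q. e (Suc 0) = 0 \<or> e 0 < Suc q * e (Suc 0))"
    by (intro env_intros *)
  moreover have "(LEAST q. b = 0 \<or> a < Suc q * b) = a div b" for a b :: nat
  proof (cases "b = 0")
    case False
    show ?thesis
    proof (rule Least_equality)
      fix q assume "b = 0 \<or> a < Suc q * b"
      with False show "a div b \<le> q" by (meson less_Suc_eq_le less_mult_imp_div_less)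
    qed (use False dividend_less_div_times[of b a] in auto)
  qed simp
  ultimately show "env_comp (\<lambda>e. e 0 div e (Suc 0))" by simp
qed

lemma env_comp_mod [env_intros]:
  "env_comp f \<Longrightarrow> env_comp g \<Longrightarrow> env_comp (\<lambda>e. f e mod g e)"
  unfolding modulo_nat_def by (intro env_intros)

lemma env_dec_even [env_intros]: "env_comp f \<Longrightarrow> env_dec (\<lambda>e. even (f e))"
  unfolding even_iff_mod_2_eq_zero by (intro env_intros)

lemma env_comp_prod_encode [env_intros]:
  "env_comp f \<Longrightarrow> env_comp g \<Longrightarrow> env_comp (\<lambda>e. prod_encode (f e, g e))"
  unfolding prod_encode_def triangle_def by (simp only: prod.case) (intro env_intros)

lemma env_comp_fst_decode [env_intros]:
  assumes "env_comp f" shows "env_comp (\<lambda>e. fst (prod_decode (f e)))"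
proof (rule env_comp_subst1[OF _ assms])
  have *: "(\<exists>b<Suc z. prod_encode (a, b) = z) \<longleftrightarrow> a = fst (prod_decode z)" for a z
  proof
    assume "a = fst (prod_decode z)"
    then have "prod_encode (a, snd (prod_decode z)) = z" by simp
    then show "\<exists>b<Suc z. prod_encode (a, b) = z" by (metis le_prod_encode_2 less_Suc_eq_le)
  qed auto
  have "env_comp (\<lambda>e. LEAST a. \<exists>b<Suc (e 0). prod_encode (a, b) = e 0)"
    by (intro env_intros) (simp only: *, blast)
  then show "env_comp (\<lambda>e. fst (prod_decode (e 0)))" by (simp only: *) (simp add: Least_equality)
qed

lemma env_comp_snd_decode [env_intros]:
  assumes "env_comp f" shows "env_comp (\<lambda>e. snd (prod_decode (f e)))"
proof (rule env_comp_subst1[OF _ assms])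
  have *: "prod_encode (fst (prod_decode z), b) = z \<longleftrightarrow> b = snd (prod_decode z)" for b z
    by (metis prod.collapse prod_decode_inverse prod_encode_inverse snd_conv)
  have "env_comp (\<lambda>e. LEAST b. prod_encode (fst (prod_decode (e 0)), b) = e 0)"
    by (intro env_intros) (simp only: *, blast)
  then show "env_comp (\<lambda>e. snd (prod_decode (e 0)))" by (simp only: *) (simp add: Least_equality)
qed

section \<open>Environments versus argument lists of fixed length\<close>

lemma env_comp_transfer:
  assumes "env_comp F"
  shows "\<exists>r. \<forall>xs. length xs = n \<longrightarrow> rec_eval r xs (F (\<lambda>i. if i < n then xs ! i else 0))"
proof -
  from assms obtain r k where r: "\<And>l e. l \<ge> k \<Longrightarrow> rec_eval r (map e [0..<l]) (F e)"
    unfolding env_comp_def by blast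
  \<comment> \<open>The threshold \<open>k\<close> may exceed the arity \<open>n\<close>;
    \<open>Zer\<close> supplies the missing variables.\<close>
  have "rec_eval (Cmp r (map (\<lambda>i. if i < n then Proj i else Zer) [0..<k])) xs
     (F (\<lambda>i. if i < n then xs ! i else 0))" if "length xs = n" for xs
    by (rule rec_eval.cmp[where ys = "map (\<lambda>i. if i < n then xs ! i else 0) [0..<k]"])
      (use that r[of k] in \<open>auto intro: rec_eval.proj rec_eval.zer\<close>)
  then show ?thesis by blast
qed

lemma computable1_iff: "computable1 f \<longleftrightarrow> env_comp (\<lambda>e. f (e 0))"
proof
  assume "computable1 f"
  then obtain r where r: "\<And>n. rec_eval r [n] (f n)" unfolding computable1_def by blast
  have "rec_eval (Cmp r [Proj 0]) (map e [0..<l]) (f (e 0))" if "l \<ge> 1" for e l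
    by (rule rec_eval.cmp[where ys = "[e 0]"])
      (use r rec_eval.proj[of 0 "map e [0..<l]"] that in auto)
  then show "env_comp (\<lambda>e. f (e 0))" unfolding env_comp_def by blast
next
  assume "env_comp (\<lambda>e. f (e 0))"
  from env_comp_transfer[OF this, of 1] obtain r where
    r: "\<And>xs. length xs = 1 \<Longrightarrow> rec_eval r xs (f (xs ! 0))"
    by auto
  have "rec_eval r [n] (f n)" for n using r[of "[n]"] by simp
  then show "computable1 f" unfolding computable1_def by blast
qed

lemma computable2_iff: "computable2 f \<longleftrightarrow> env_comp (\<lambda>e. f (e 0) (e (Suc 0)))"
proof
  assume "computable2 f"
  then obtain r where r: "\<And>n m. rec_eval r [n, m] (f n m)" unfolding computable2_def by blast
  have "rec_eval (Cmp r [Proj 0, Proj 1]) (map e [0..<l]) (f (e 0) (e (Suc 0)))" if "l \<ge> 2" for e l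
    by (rule rec_eval.cmp[where ys = "[e 0, e (Suc 0)]"])
      (use r rec_eval.proj[of 0 "map e [0..<l]"] rec_eval.proj[of 1 "map e [0..<l]"] that
        in \<open>auto simp: less_Suc_eq\<close>)
  then show "env_comp (\<lambda>e. f (e 0) (e (Suc 0)))" unfolding env_comp_def by blast
next
  assume "env_comp (\<lambda>e. f (e 0) (e (Suc 0)))"
  from env_comp_transfer[OF this, of 2] obtain r where
    r: "\<And>xs. length xs = 2 \<Longrightarrow> rec_eval r xs (f (xs ! 0) (xs ! Suc 0))"
    by auto
  have "rec_eval r [n, m] (f n m)" for n m using r[of "[n, m]"] by simp
  then show "computable2 f" unfolding computable2_def by blast
qed

lemma env_comp_of_computable3:
  assumes "computable3 f" "env_comp a" "env_comp b" "env_comp c"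
  shows "env_comp (\<lambda>e. f (a e) (b e) (c e))"
proof -
  obtain r where r: "\<And>n m k. rec_eval r [n, m, k] (f n m k)"
    using assms(1) unfolding computable3_def by blast
  have "rec_eval (Cmp r [Proj 0, Proj 1, Proj 2]) (map e [0..<l]) (f (e 0) (e 1) (e 2))"
    if "l \<ge> 3" for e l
    by (rule rec_eval.cmp[where ys = "[e 0, e 1, e 2]"])
      (use r rec_eval.proj[of 0 "map e [0..<l]"] rec_eval.proj[of 1 "map e [0..<l]"]
        rec_eval.proj[of 2 "map e [0..<l]"] that in \<open>auto simp: less_Suc_eq numeral_2_eq_2 numeral_3_eq_3\<close>)
  then have "env_comp (\<lambda>e. f (e 0) (e 1) (e 2))" unfolding env_comp_def by blast
  from env_comp_subst[OF this, of "case_nat a (case_nat b (\<lambda>_. c))"] assms(2-4)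
  show ?thesis by (simp add: numeral_2_eq_2 split: nat.split)
qed

lemma env_comp_of_computable1:
  "computable1 f \<Longrightarrow> env_comp a \<Longrightarrow> env_comp (\<lambda>e. f (a e))"
  unfolding computable1_iff by (rule env_comp_subst1)

lemma env_comp_of_computable2:
  "computable2 f \<Longrightarrow> env_comp a \<Longrightarrow> env_comp b \<Longrightarrow> env_comp (\<lambda>e. f (a e) (b e))"
  unfolding computable2_iff by (rule env_comp_subst2)

section \<open>Step-bounded evaluation\<close>

inductive_cases rec_eval_ScE: "rec_eval Sc xs y"
inductive_cases rec_eval_ProjE: "rec_eval (Proj i) xs y"
inductive_cases rec_eval_CmpE: "rec_eval (Cmp f gs) xs y"
inductive_cases rec_eval_PrimE: "rec_eval (Prim f g) xs y"
inductive_cases rec_eval_MnE: "rec_eval (Mn f) xs y"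

text \<open>\<open>G t e\<close> is 0 if no result is known at stage \<open>t\<close>, and
  \<open>Suc y\<close> if the result is \<open>y\<close>. Completeness asks for all large
  \<open>t\<close>, not for some \<open>t\<close>: then finitely many subcomputations have a common
  stage without any monotonicity in \<open>t\<close>.\<close>

definition staged_eval :: "recf \<Rightarrow> nat \<Rightarrow> (nat \<Rightarrow> (nat \<Rightarrow> nat) \<Rightarrow> nat) \<Rightarrow> bool" where
  "staged_eval r l G \<longleftrightarrow> env_comp (\<lambda>e. G (e 0) (\<lambda>i. e (Suc i))) \<and>
     (\<forall>t e y. G t e = Suc y \<longrightarrow> rec_eval r (map e [0..<l]) y) \<and>
     (\<forall>e y. rec_eval r (map e [0..<l]) y \<longrightarrow> (\<forall>\<^sub>F t in sequentially. G t e = Suc y))"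

lemma staged_evalI:
  assumes "env_comp (\<lambda>e. G (e 0) (\<lambda>i. e (Suc i)))"
    and "\<And>t e y. G t e = Suc y \<Longrightarrow> rec_eval r (map e [0..<l]) y"
    and "\<And>e y. rec_eval r (map e [0..<l]) y \<Longrightarrow> \<forall>\<^sub>F t in sequentially. G t e = Suc y"
  shows "staged_eval r l G"
  using assms unfolding staged_eval_def by blast

lemma staged_eval_sound: "staged_eval r l G \<Longrightarrow> G t e = Suc y \<Longrightarrow> rec_eval r (map e [0..<l]) y"
  and staged_eval_complete: "staged_eval r l G \<Longrightarrow> rec_eval r (map e [0..<l]) y \<Longrightarrow>
    \<forall>\<^sub>F t in sequentially. G t e = Suc y"
  unfolding staged_eval_def by blast+

lemma env_comp_staged_eval:
  assumes "staged_eval r l G" "env_comp t" "\<And>i. env_comp (h i)"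
  shows "env_comp (\<lambda>e. G (t e) (\<lambda>i. h i e))"
proof -
  have "env_comp (\<lambda>e. G (e 0) (\<lambda>i. e (Suc i)))" using assms(1) unfolding staged_eval_def by blast
  from env_comp_subst[OF this, of "case_nat t h"] assms(2,3)
  show ?thesis by (simp split: nat.split)
qed

lemma env_comp_prod_lessThan:
  fixes h :: "nat \<Rightarrow> (nat \<Rightarrow> nat) \<Rightarrow> nat"
  assumes "\<And>i. env_comp (h i)" shows "env_comp (\<lambda>e. \<Prod>i<n. h i e)"
proof (induction n)
  case 0
  show ?case by (simp add: env_comp_const)
next
  case (Suc n)
  then have "env_comp (\<lambda>e. (\<Prod>i<n. h i e) * h n e)" by (intro env_intros assms)
  then show ?case by simp
qed

lemma map_case_nat_upt: "map (case_nat x e) [0..<Suc l] = x # map e [0..<l]"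
  by (simp only: map_upt_Suc nat.case)

lemma staged_eval_Cmp:
  assumes f: "staged_eval f (length gs) F" and gs: "\<And>i. i < length gs \<Longrightarrow> staged_eval (gs ! i) l (G i)"
    and G0: "\<And>i. \<not> i < length gs \<Longrightarrow> G i = (\<lambda>t e. 0)"
  shows "staged_eval (Cmp f gs) l
     (\<lambda>t e. if (\<Prod>i<length gs. G i t e) = 0 then 0 else F t (\<lambda>i. G i t e - 1))"
proof (rule staged_evalI)
  have G: "env_comp (\<lambda>e. G i (e 0) (\<lambda>i. e (Suc i)))" for i
    using gs[of i] G0[of i] env_comp_const unfolding staged_eval_def by (cases "i < length gs") auto
  show "env_comp (\<lambda>e. if (\<Prod>i<length gs. G i (e 0) (\<lambda>i. e (Suc i))) = 0 then 0
       else F (e 0) (\<lambda>i. G i (e 0) (\<lambda>i. e (Suc i)) - 1))"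
    by (intro env_intros env_comp_prod_lessThan env_comp_staged_eval[OF f] G)
next
  fix t e y
  assume "(if (\<Prod>i<length gs. G i t e) = 0 then 0 else F t (\<lambda>i. G i t e - 1)) = Suc y"
  then have nz: "\<And>i. i < length gs \<Longrightarrow> G i t e \<noteq> 0" and F: "F t (\<lambda>i. G i t e - 1) = Suc y"
    by (auto split: if_splits)
  show "rec_eval (Cmp f gs) (map e [0..<l]) y"
  proof (rule rec_eval.cmp[OF _ _ staged_eval_sound[OF f, OF F]])
    show "\<forall>i<length gs. rec_eval (gs ! i) (map e [0..<l]) (map (\<lambda>i. G i t e - 1) [0..<length gs] ! i)"
      using nz by (auto intro!: staged_eval_sound[OF gs])
  qed simp
next
  fix e y
  assume "rec_eval (Cmp f gs) (map e [0..<l]) y"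
  then obtain ys where ys: "length ys = length gs"
    and g: "\<And>i. i < length gs \<Longrightarrow> rec_eval (gs ! i) (map e [0..<l]) (ys ! i)" and fy: "rec_eval f ys y"
    by (auto elim: rec_eval_CmpE)
  \<comment> \<open>\<open>F\<close> might inspect variables beyond its arity, and its completeness
    concerns one fixed environment. Therefore the values passed on are 0 beyond
    \<open>length gs\<close>, at every stage.\<close>
  let ?e = "\<lambda>i. if i < length gs then ys ! i else 0"
  have "map ?e [0..<length gs] = ys" using ys by (intro nth_equalityI) auto
  with fy have 1: "\<forall>\<^sub>F t in sequentially. F t ?e = Suc y"
    by (intro staged_eval_complete[OF f]) simp
  have 2: "\<forall>\<^sub>F t in sequentially. \<forall>i\<in>{..<length gs}. G i t e = Suc (ys ! i)"
    by (intro eventually_ball_finite ballI staged_eval_complete[OF gs] g) simp_all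
  show "\<forall>\<^sub>F t in sequentially.
      (if (\<Prod>i<length gs. G i t e) = 0 then 0 else F t (\<lambda>i. G i t e - 1)) = Suc y"
  proof (rule eventually_mono[OF eventually_conj[OF 1 2]])
    fix t assume t: "F t ?e = Suc y \<and> (\<forall>i\<in>{..<length gs}. G i t e = Suc (ys ! i))"
    have "(\<lambda>i. G i t e - 1) = ?e"
    proof
      fix i
      show "G i t e - 1 = ?e i" using t G0[of i] by (cases "i < length gs") auto
    qed
    with t show "(if (\<Prod>i<length gs. G i t e) = 0 then 0 else F t (\<lambda>i. G i t e - 1)) = Suc y"
      by auto
  qed
qed

lemma staged_eval_Prim:
  assumes f: "staged_eval f l F" and g: "staged_eval g (Suc (Suc l)) G"
  shows "staged_eval (Prim f g) (Suc l)
     (\<lambda>t e. rec_nat (F t (\<lambda>i. e (Suc i)))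
        (\<lambda>n y. if y = 0 then 0 else G t (case_nat n (case_nat (y - 1) (\<lambda>i. e (Suc i))))) (e 0))"
    (is "staged_eval _ _ (\<lambda>t e. ?R t e (e 0))")
proof (rule staged_evalI)
  have "env_comp (\<lambda>e. G (t e) (case_nat (n e) (case_nat (y e) (\<lambda>i. h i e))))"
    if "env_comp t" "env_comp n" "env_comp y" "\<And>i. env_comp (h i)" for t n y and h :: "nat \<Rightarrow> (nat \<Rightarrow> nat) \<Rightarrow> nat"
  proof -
    have eq: "case_nat (n e) (case_nat (y e) (\<lambda>i. h i e)) = (\<lambda>i. case_nat n (case_nat y h) i e)" for e
      by (auto simp: fun_eq_iff split: nat.split)
    show ?thesis unfolding eq
      by (intro env_comp_staged_eval[OF g]) (auto intro: that split: nat.split)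
  qed
  note this[env_intros]
  show "env_comp (\<lambda>e. ?R (e 0) (\<lambda>i. e (Suc i)) (e (Suc 0)))"
    by (intro env_intros env_comp_staged_eval[OF f])
next
  have "rec_eval (Prim f g) (n # map (\<lambda>i. e (Suc i)) [0..<l]) y" if "?R t e n = Suc y" for t e n y
    using that
  proof (induction n arbitrary: y)
    case 0
    then show ?case by (auto intro: rec_eval.prim0 staged_eval_sound[OF f])
  next
    case (Suc n)
    then obtain z where z: "?R t e n = Suc z"
      and y: "G t (case_nat n (case_nat z (\<lambda>i. e (Suc i)))) = Suc y"
      by (cases "?R t e n") auto
    from staged_eval_sound[OF g, OF y] Suc.IH[OF z] show ?case
      by (auto simp: map_case_nat_upt simp del: upt_Suc intro: rec_eval.primS)
  qed
  then show "rec_eval (Prim f g) (map e [0..<Suc l]) y" if "?R t e (e 0) = Suc y" for t e y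
    using that unfolding map_upt_Suc by blast
next
  have "\<forall>\<^sub>F t in sequentially. ?R t e n = Suc y"
    if "rec_eval (Prim f g) (n # map (\<lambda>i. e (Suc i)) [0..<l]) y" for e n y
    using that
  proof (induction n arbitrary: y)
    case 0
    then show ?case by (auto elim!: rec_eval_PrimE intro: staged_eval_complete[OF f])
  next
    case (Suc n)
    from Suc.prems obtain z where z: "rec_eval (Prim f g) (n # map (\<lambda>i. e (Suc i)) [0..<l]) z"
      and y: "rec_eval g (n # z # map (\<lambda>i. e (Suc i)) [0..<l]) y"
      by (auto elim: rec_eval_PrimE)
    have "\<forall>\<^sub>F t in sequentially. G t (case_nat n (case_nat z (\<lambda>i. e (Suc i)))) = Suc y"
      using y by (intro staged_eval_complete[OF g]) (simp add: map_case_nat_upt del: upt_Suc)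
    with Suc.IH[OF z] show ?case by eventually_elim simp
  qed
  then show "\<forall>\<^sub>F t in sequentially. ?R t e (e 0) = Suc y"
    if "rec_eval (Prim f g) (map e [0..<Suc l]) y" for e y
    using that unfolding map_upt_Suc by blast
qed

text \<open>A value at most 1 at stage \<open>t\<close> means an unknown result or the result 0; the
  search stops there, or at \<open>t\<close> at the latest. Only the value 1 is reported, so an
  unknown result below the true minimum blocks the answer instead of falsifying it.\<close>

lemma staged_eval_Mn:
  assumes f: "staged_eval f (Suc l) F"
  shows "staged_eval (Mn f) l
     (\<lambda>t e. let z = (LEAST n. n = t \<or> F t (case_nat n e) \<le> 1)
            in if F t (case_nat z e) = 1 then Suc z else 0)"
    (is "staged_eval _ _ (\<lambda>t e. let z = ?Z t e in _)")
proof (rule staged_evalI)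
  have "env_comp (\<lambda>e. F (t e) (case_nat (n e) (\<lambda>i. h i e)))"
    if "env_comp t" "env_comp n" "\<And>i. env_comp (h i)" for t n and h :: "nat \<Rightarrow> (nat \<Rightarrow> nat) \<Rightarrow> nat"
  proof -
    have eq: "case_nat (n e) (\<lambda>i. h i e) = (\<lambda>i. case_nat n h i e)" for e
      by (auto simp: fun_eq_iff split: nat.split)
    show ?thesis unfolding eq
      by (intro env_comp_staged_eval[OF f]) (auto intro: that split: nat.split)
  qed
  note this[env_intros]
  show "env_comp (\<lambda>e. let z = ?Z (e 0) (\<lambda>i. e (Suc i))
     in if F (e 0) (case_nat z (\<lambda>i. e (Suc i))) = 1 then Suc z else 0)"
    unfolding Let_def by (intro env_intros) auto
next
  fix t e y
  assume *: "(let z = ?Z t e in if F t (case_nat z e) = 1 then Suc z else 0) = Suc y"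
  then have y: "?Z t e = y" "F t (case_nat y e) = 1"
    by (auto simp: Let_def split: if_splits)
  show "rec_eval (Mn f) (map e [0..<l]) y"
  proof (rule rec_eval.mn)
    show "rec_eval f (y # map e [0..<l]) 0"
      using staged_eval_sound[OF f, of t "case_nat y e" 0] y by (simp add: map_case_nat_upt del: upt_Suc)
    show "\<forall>m<y. \<exists>k. rec_eval f (m # map e [0..<l]) (Suc k)"
    proof (intro allI impI)
      fix m assume "m < y"
      with y(1) have "\<not> F t (case_nat m e) \<le> 1" using not_less_Least by blast
      then have "F t (case_nat m e) = Suc (Suc (F t (case_nat m e) - 2))" by simp
      from staged_eval_sound[OF f, OF this] show "\<exists>k. rec_eval f (m # map e [0..<l]) (Suc k)"
        by (auto simp: map_case_nat_upt simp del: upt_Suc)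
    qed
  qed
next
  fix e y
  assume "rec_eval (Mn f) (map e [0..<l]) y"
  then obtain k where y: "rec_eval f (y # map e [0..<l]) 0"
    and k: "\<And>m. m < y \<Longrightarrow> rec_eval f (m # map e [0..<l]) (Suc (k m))"
    by (auto elim!: rec_eval_MnE) metis
  have "\<forall>\<^sub>F t in sequentially. \<forall>m\<in>{..<y}. F t (case_nat m e) = Suc (Suc (k m))"
    using k by (intro eventually_ball_finite ballI staged_eval_complete[OF f])
      (auto simp: map_case_nat_upt simp del: upt_Suc)
  moreover have "\<forall>\<^sub>F t in sequentially. F t (case_nat y e) = Suc 0"
    using y by (intro staged_eval_complete[OF f]) (simp add: map_case_nat_upt del: upt_Suc)
  moreover have "\<forall>\<^sub>F t in sequentially. y < t" by (rule eventually_gt_at_top)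
  ultimately show "\<forall>\<^sub>F t in sequentially.
      (let z = ?Z t e in if F t (case_nat z e) = 1 then Suc z else 0) = Suc y"
  proof eventually_elim
    case (elim t)
    have "?Z t e = y"
    proof (rule Least_equality)
      show "y \<le> n" if "n = t \<or> F t (case_nat n e) \<le> 1" for n
        using elim that by (cases "n < y") auto
    qed (use elim in simp)
    with elim show ?case by (simp add: Let_def)
  qed
qed

text \<open>The induction leaves \<open>l\<close> free, since subprograms run at other arities.
  Programs stuck at an arity, such as \<open>Sc\<close> or \<open>Prim\<close> on the empty list,
  get the stage function 0.\<close>

lemma ex_staged_eval: "\<exists>G. staged_eval r l G"
proof (induction r arbitrary: l)
  case Zer
  have "staged_eval Zer l (\<lambda>t e. 1)"
    by (rule staged_evalI) (auto intro: env_intros rec_eval.zer elim: rec_eval.cases)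
  then show ?case by blast
next
  case Sc
  show ?case
  proof (cases l)
    case 0
    have "staged_eval Sc l (\<lambda>t e. 0)"
      by (rule staged_evalI) (auto simp: 0 intro: env_intros elim: rec_eval_ScE)
    then show ?thesis by blast
  next
    case (Suc m)
    have "staged_eval Sc l (\<lambda>t e. Suc (Suc (e 0)))"
      unfolding Suc
      by (rule staged_evalI)
        (auto simp: map_upt_Suc simp del: upt_Suc intro: rec_eval.sc intro!: env_comp_Suc env_comp_var elim: rec_eval_ScE)
    then show ?thesis by blast
  qed
next
  case (Proj i)
  show ?case
  proof (cases "i < l")
    case True
    have "staged_eval (Proj i) l (\<lambda>t e. Suc (e i))"
      using True rec_eval.proj[of i "map _ [0..<l]"]
      by (intro staged_evalI) (auto intro: env_intros elim!: rec_eval_ProjE)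
    then show ?thesis by blast
  next
    case False
    have "staged_eval (Proj i) l (\<lambda>t e. 0)"
      by (rule staged_evalI) (auto simp: False intro: env_intros elim: rec_eval_ProjE)
    then show ?thesis by blast
  qed
next
  case (Cmp f gs)
  obtain F where F: "staged_eval f (length gs) F" using Cmp.IH(1) by blast
  have "\<forall>i. \<exists>G. if i < length gs then staged_eval (gs ! i) l G else G = (\<lambda>t e. 0)"
    using Cmp.IH(2)[OF nth_mem] by auto
  then obtain G where "\<And>i. if i < length gs then staged_eval (gs ! i) l (G i) else G i = (\<lambda>t e. 0)"
    by metis
  with staged_eval_Cmp[OF F, of l G] show ?case by (auto split: if_splits)
next
  case (Prim f g)
  show ?case
  proof (cases l)
    case 0
    have "staged_eval (Prim f g) l (\<lambda>t e. 0)"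
      by (rule staged_evalI) (auto simp: 0 intro: env_intros elim: rec_eval_PrimE)
    then show ?thesis by blast
  next
    case (Suc m)
    then show ?thesis using Prim.IH staged_eval_Prim by blast
  qed
next
  case (Mn f)
  then show ?case using staged_eval_Mn by blast
qed

text \<open>The second argument of the computable relation bounds the number of steps.\<close>
lemma ce_set_staged:
  assumes "ce_set S"
  obtains T where "computable2 T" "\<And>n. n \<in> S \<longleftrightarrow> (\<exists>t. T n t \<noteq> 0)"
proof -
  obtain r where r: "\<And>n. n \<in> S \<longleftrightarrow> (\<exists>y. rec_eval r [n] y)"
    using assms unfolding ce_set_def by blast
  obtain G where G: "staged_eval r 1 G" using ex_staged_eval by blast
  have "computable2 (\<lambda>n t. G t (\<lambda>_. n))"
    unfolding computable2_iff by (intro env_comp_staged_eval[OF G] env_intros)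
  moreover have "n \<in> S \<longleftrightarrow> (\<exists>t. G t (\<lambda>_. n) \<noteq> 0)" for n
  proof
    assume "n \<in> S"
    then obtain y where "rec_eval r (map (\<lambda>_. n) [0..<1]) y" using r by auto
    from staged_eval_complete[OF G, OF this]
    obtain N where "\<And>t. t \<ge> N \<Longrightarrow> G t (\<lambda>_. n) = Suc y"
      unfolding eventually_sequentially by blast
    from this[OF order_refl] have "G N (\<lambda>_. n) \<noteq> 0" by simp
    then show "\<exists>t. G t (\<lambda>_. n) \<noteq> 0" by blast
  next
    assume "\<exists>t. G t (\<lambda>_. n) \<noteq> 0"
    then obtain t y where "G t (\<lambda>_. n) = Suc y" using not0_implies_Suc by blast
    from staged_eval_sound[OF G, OF this] r show "n \<in> S" by auto
  qed
  ultimately show thesis by (rule that)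
qed

section \<open>Coding bounded sequences by real numbers\<close>

definition brackets :: "nat \<Rightarrow> nat \<Rightarrow> real \<Rightarrow> bool" where
  "brackets v D c \<longleftrightarrow> real v \<le> c * real D \<and> c * real D \<le> real v + 1"

text \<open>Integers are enumerated as 0, -1, 1, -2, ..., and denominators are stored minus one;
  hence the codes \<open>2 * j\<close>, \<open>2\<close> and \<open>2 * D - 1\<close> below.\<close>

lemma rat_dec_nonneg: "rat_dec (prod_encode (2 * j, b)) = real j / real (Suc b)"
proof -
  have "int_decode (2 * j) = int j"
    by (simp add: int_decode_def sum_decode_def)
  then show ?thesis by (simp add: rat_dec_def)
qed

locale mixed_radix =
  fixes N :: "nat \<Rightarrow> nat"
  assumes N_pos: "N i > 0"
begin

text \<open>A sequence with \<open>s i < N i\<close> is coded by the real number with mixed radix digits \<open>2 * s i\<close> to the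
  bases \<open>2 * N i\<close>. As all digits are even, the intervals \<open>[val s n, val s n + 1] / scale n\<close> of different
  words of length \<open>n\<close> are a positive distance apart, so digits can be read off approximations.\<close>
definition scale :: "nat \<Rightarrow> nat" where
  "scale n = rec_nat 1 (\<lambda>i y. y * (2 * N i)) n"

definition val :: "(nat \<Rightarrow> nat) \<Rightarrow> nat \<Rightarrow> nat" where
  "val s n = rec_nat 0 (\<lambda>i y. y * (2 * N i) + 2 * s i) n"

text \<open>With \<open>u\<close> read as the fraction \<open>u / scale t\<close>, the division
  truncates to \<open>Suc i\<close> places, \<open>mod\<close> isolates the last of them and halving
  undoes the doubling. The result is a legal digit even if \<open>u\<close> codes no word.\<close>

definition digit :: "nat \<Rightarrow> nat \<Rightarrow> nat \<Rightarrow> nat" where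
  "digit t u i = (u * scale (Suc i) div scale t) mod (2 * N i) div 2"

lemma scale_simps [simp]: "scale 0 = 1" "scale (Suc n) = scale n * (2 * N n)"
  by (simp_all add: scale_def)

lemma val_simps [simp]: "val s 0 = 0" "val s (Suc n) = val s n * (2 * N n) + 2 * s n"
  by (simp_all add: val_def)

lemma scale_pos: "scale n > 0"
  by (induction n) (simp_all add: N_pos)

lemma val_cong: "(\<And>i. i < n \<Longrightarrow> s i = s' i) \<Longrightarrow> val s n = val s' n"
  by (induction n) simp_all

lemma digit_less: "digit t u i < N i"
  using N_pos[of i] mod_less_divisor[of "2 * N i" "u * scale (Suc i) div scale t"]
  unfolding digit_def by linarith

text \<open>One half of the nesting of the intervals, cross-multiplied to stay within the naturals:
  left endpoints never decrease.\<close>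

lemma val_scale_lower: "i \<le> t \<Longrightarrow> val s i * scale t \<le> val s t * scale i"
proof (induction t rule: dec_induct)
  case (step t)
  have "val s i * scale t * (2 * N t) \<le> val s t * scale i * (2 * N t)"
    using step.IH by (rule mult_right_mono) simp
  also have "\<dots> \<le> val s (Suc t) * scale i" by (simp add: algebra_simps)
  finally show ?case by (simp only: scale_simps ac_simps)
qed simp

lemma val_scale_upper:
  assumes s: "\<And>i. s i < N i" and "i \<le> t"
  shows "(val s t + 1) * scale i \<le> (val s i + 1) * scale t"
  using \<open>i \<le> t\<close>
proof (induction t rule: dec_induct)
  case (step t)
  \<comment> \<open>One unit of the old scale holds \<open>2 * N t\<close> new ones, so right
    endpoints do not grow.\<close>
  have "2 * s t + 1 \<le> 2 * N t" using s[of t] by simp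
  then have "(val s (Suc t) + 1) * scale i \<le> ((val s t + 1) * (2 * N t)) * scale i"
    by (intro mult_right_mono) (simp_all add: algebra_simps)
  also have "\<dots> = (val s t + 1) * scale i * (2 * N t)" by (simp only: ac_simps)
  also have "\<dots> \<le> (val s i + 1) * scale t * (2 * N t)"
    using step.IH by (rule mult_right_mono) simp
  finally show ?case by (simp only: scale_simps ac_simps)
qed simp

lemma digit_val:
  assumes s: "\<And>i. s i < N i" and "i < t"
  shows "digit t (val s t) i = s i"
proof -
  have "val s t * scale (Suc i) div scale t = val s (Suc i)"
  proof (rule div_nat_eqI)
    show "scale t * val s (Suc i) \<le> val s t * scale (Suc i)"
      using val_scale_lower[of "Suc i" t s] \<open>i < t\<close> by (simp only: ac_simps Suc_leI)
    have "val s t * scale (Suc i) < (val s t + 1) * scale (Suc i)" using scale_pos[of "Suc i"] by simp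
    also have "\<dots> \<le> (val s (Suc i) + 1) * scale t" using val_scale_upper[of s "Suc i" t] s \<open>i < t\<close> by simp
    finally show "val s t * scale (Suc i) < scale t * Suc (val s (Suc i))" by (simp only: ac_simps Suc_eq_plus1)
  qed
  then show ?thesis using s[of i] by (simp add: digit_def)
qed

lemma brackets_mono:
  assumes s: "\<And>i. s i < N i" and "i \<le> t" and c: "brackets (val s t) (scale t) c"
  shows "brackets (val s i) (scale i) c"
proof -
  have D: "real (scale t) > 0" "real (scale i) \<ge> 0" using scale_pos by simp_all
  have "real (val s i) * real (scale t) \<le> real (val s t) * real (scale i)"
    using val_scale_lower[OF \<open>i \<le> t\<close>, of s] by (metis of_nat_le_iff of_nat_mult)
  also have "\<dots> \<le> (c * real (scale t)) * real (scale i)"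
    using c D unfolding brackets_def by (intro mult_right_mono) auto
  finally have "real (val s i) * real (scale t) \<le> (c * real (scale i)) * real (scale t)"
    by (simp add: ac_simps)
  then have "real (val s i) \<le> c * real (scale i)" using D by simp
  moreover have "(c * real (scale i)) * real (scale t) \<le> (real (val s t) + 1) * real (scale i)"
    using mult_right_mono[of "c * real (scale t)" "real (val s t) + 1" "real (scale i)"] c
    unfolding brackets_def by (simp add: ac_simps)
  moreover have "\<dots> \<le> (real (val s i) + 1) * real (scale t)"
    using val_scale_upper[OF s \<open>i \<le> t\<close>]
    by (metis (no_types, lifting) of_nat_1 of_nat_add of_nat_le_iff of_nat_mult)
  ultimately have "(c * real (scale i)) * real (scale t) \<le> (real (val s i) + 1) * real (scale t)"
    by linarith
  then have "c * real (scale i) \<le> real (val s i) + 1" using D by simp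
  with \<open>real (val s i) \<le> c * real (scale i)\<close> show ?thesis unfolding brackets_def by simp
qed

lemma brackets_unique:
  assumes s: "\<And>i. s i < N i" and s': "\<And>i. s' i < N i"
    and c: "brackets (val s t) (scale t) c" and c': "brackets (val s' t) (scale t) c" and "i < t"
  shows "s i = s' i"
  using \<open>i < t\<close>
proof (induction i rule: less_induct)
  case (less i)
  have "val s i = val s' i" using less by (intro val_cong) simp
  moreover have "brackets (val s (Suc i)) (scale (Suc i)) c" "brackets (val s' (Suc i)) (scale (Suc i)) c"
    using brackets_mono[of s "Suc i" t c] brackets_mono[of s' "Suc i" t c] s s' c c' less.prems by auto
  ultimately have "real (2 * s i) \<le> real (2 * s' i + 1)" "real (2 * s' i) \<le> real (2 * s i + 1)"
    unfolding brackets_def by simp_all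
  then have "2 * s i \<le> 2 * s' i + 1" "2 * s' i \<le> 2 * s i + 1" by (simp_all only: of_nat_le_iff)
  then show ?case by presburger
qed

text \<open>Nested intervals: the supremum of the left endpoints lies below all right endpoints. The
  word of length 0 gives the interval [0, 1].\<close>

lemma ex_bracketed:
  assumes s: "\<And>i. s i < N i"
  shows "\<exists>c\<in>{0..1}. \<forall>t. brackets (val s t) (scale t) c"
proof -
  define f where "f t = real (val s t) / real (scale t)" for t
  have D: "real (scale t) > 0" for t using scale_pos by simp
  have up: "f i \<le> (real (val s t) + 1) / real (scale t)" for i t
  proof -
    have "real (val s i) * real (scale t) \<le> (real (val s t) + 1) * real (scale i)"
    proof (cases "i \<le> t")
      case True
      then have "val s i * scale t \<le> (val s t + 1) * scale i"
        using val_scale_lower[of i t s] by (simp add: trans_le_add1)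
      then show ?thesis by (metis (no_types, lifting) of_nat_1 of_nat_add of_nat_le_iff of_nat_mult)
    next
      case False
      then have "(val s i + 1) * scale t \<le> (val s t + 1) * scale i"
        using val_scale_upper[of s t i] s by simp
      then have "val s i * scale t \<le> (val s t + 1) * scale i" by simp
      then show ?thesis by (metis (no_types, lifting) of_nat_1 of_nat_add of_nat_le_iff of_nat_mult)
    qed
    then show ?thesis using D[of i] D[of t] by (simp add: f_def field_simps)
  qed
  define c where "c = (SUP i. f i)"
  have bdd: "bdd_above (range f)" using up by (intro bdd_aboveI2)
  have lo: "f t \<le> c" for t unfolding c_def using bdd by (intro cSUP_upper) auto
  have hi: "c \<le> (real (val s t) + 1) / real (scale t)" for t
    unfolding c_def using up by (intro cSUP_least) auto
  have "brackets (val s t) (scale t) c" for t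
    using lo[of t] hi[of t] D[of t] by (simp add: brackets_def f_def field_simps)
  moreover from this[of 0] have "c \<in> {0..1}" by (simp add: brackets_def)
  ultimately show ?thesis by blast
qed

text \<open>The quotient rounds \<open>x * D\<close> to a nearest integer, for
  \<open>x = a / b\<close> and \<open>D = scale (Suc i)\<close>. Since \<open>c * D\<close> lies in
  [v, v + 1] and the error is below 1/2, rounding yields \<open>v\<close> or \<open>v + 1\<close>.
  The last digit of \<open>v\<close> is even and below \<open>2 * N i - 1\<close>, so adding 1
  causes no carry, and halving gives \<open>s i\<close> in both cases.\<close>

lemma digit_of_approx:
  fixes a b :: nat
  assumes s: "s i < N i" and c: "brackets (val s (Suc i)) (scale (Suc i)) c" and b: "b > 0"
    and approx: "\<bar>real a / real b - c\<bar> * (2 * real (scale (Suc i))) < 1"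
  shows "((2 * a * scale (Suc i) + b) div (2 * b)) mod (2 * N i) div 2 = s i"
proof -
  define D where "D = scale (Suc i)"
  define v where "v = val s (Suc i)"
  define w where "w = (2 * a * D + b) div (2 * b)"
  have D: "real D > 0" unfolding D_def using scale_pos[of "Suc i"] by (simp only: of_nat_0_less_iff)
  define x where "x = real a / real b"
  have "\<bar>x * real D - c * real D\<bar> * 2 < 1"
  proof -
    have "\<bar>x * real D - c * real D\<bar> = \<bar>x - c\<bar> * real D"
      using D by (simp add: left_diff_distrib[symmetric] abs_mult)
    then show ?thesis using approx unfolding x_def[symmetric] D_def[symmetric] by simp
  qed
  then have x: "real v - 1/2 < x * real D" "x * real D < real v + 3/2"
    using c unfolding brackets_def D_def[symmetric] v_def[symmetric] by (auto simp: abs_if split: if_splits)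
  have xD: "x * real D = real (a * D) / real b" by (simp add: x_def)
  have "real (v * (2 * b)) \<le> real (2 * a * D + b)"
    using x(1) b unfolding xD by (simp add: field_simps)
  then have lo: "v * (2 * b) \<le> 2 * a * D + b" by (simp only: of_nat_le_iff)
  have "real (2 * a * D + b) < real ((v + 2) * (2 * b))"
    using x(2) b unfolding xD by (simp add: field_simps)
  then have hi: "2 * a * D + b < (v + 2) * (2 * b)" by (simp only: of_nat_less_iff)
  have "v \<le> w" using lo b by (simp add: w_def less_eq_div_iff_mult_less_eq)
  moreover have "w < v + 2" unfolding w_def using hi by (rule less_mult_imp_div_less)
  ultimately have "w = v \<or> w = v + 1" by linarith
  moreover have "v mod (2 * N i) = 2 * s i" using s by (simp add: v_def)
  moreover have "(v + 1) mod (2 * N i) = 2 * s i + 1"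
  proof -
    have "v + 1 = (2 * s i + 1) + val s i * (2 * N i)" by (simp add: v_def)
    then have "(v + 1) mod (2 * N i) = (2 * s i + 1) mod (2 * N i)" by (simp only: mod_mult_self1)
    then show ?thesis using s by simp
  qed
  ultimately have "w mod (2 * N i) div 2 = s i" by auto
  then show ?thesis by (simp only: w_def D_def)
qed

text \<open>Not every \<open>u\<close> is a value of \<open>val\<close>: no odd one is, for
  instance. Decoding and encoding again recognises the values without a search.\<close>

definition good :: "(nat \<Rightarrow> (nat \<Rightarrow> nat) \<Rightarrow> bool) \<Rightarrow> nat \<Rightarrow> nat \<Rightarrow> bool" where
  "good Q t u \<longleftrightarrow> val (digit (Suc t) u) (Suc t) = u \<and> Q t (digit (Suc t) u)"

text \<open>Stage \<open>t\<close> uses words of length \<open>Suc t\<close> because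
  \<open>Q t\<close> may depend on the entries up to and including \<open>t\<close>.\<close>

definition code_set :: "(nat \<Rightarrow> (nat \<Rightarrow> nat) \<Rightarrow> bool) \<Rightarrow> real set" where
  "code_set Q = {c \<in> {0..1}. \<forall>t. \<exists>u. good Q t u \<and> brackets u (scale (Suc t)) c}"

lemma code_set_nonempty:
  assumes s: "\<And>i. s i < N i" and Q: "\<And>t. Q t s"
    and cong: "\<And>t s s'. (\<And>i. i \<le> t \<Longrightarrow> s i = s' i) \<Longrightarrow> Q t s = Q t s'"
  shows "code_set Q \<noteq> {}"
proof -
  obtain c where c: "c \<in> {0..1}" "\<And>t. brackets (val s t) (scale t) c"
    using ex_bracketed[of s] s by blast
  have "good Q t (val s (Suc t))" for t
  proof -
    have d: "digit (Suc t) (val s (Suc t)) i = s i" if "i \<le> t" for i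
      using digit_val[of s i "Suc t"] s that by (simp only: less_Suc_eq_le)
    then show ?thesis
      unfolding good_def using Q[of t] cong[of t s "digit (Suc t) (val s (Suc t))"]
      by (auto intro!: val_cong simp del: val_simps)
  qed
  with c show ?thesis unfolding code_set_def by blast
qed

text \<open>Different stages may be witnessed by unrelated words. As all their intervals contain the
  same \<open>c\<close>, uniqueness forces them to extend one another, and the diagonal is their
  common limit.\<close>

lemma code_setD:
  assumes c: "c \<in> code_set Q"
    and cong: "\<And>t s s'. (\<And>i. i \<le> t \<Longrightarrow> s i = s' i) \<Longrightarrow> Q t s = Q t s'"
  obtains s where "\<And>i. s i < N i" "\<And>t. Q t s" "\<And>t. brackets (val s t) (scale t) c"
proof -
  from c obtain u where u: "\<And>t. good Q t (u t)" "\<And>t. brackets (u t) (scale (Suc t)) c"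
    unfolding code_set_def by auto metis
  define \<sigma> where "\<sigma> t = digit (Suc t) (u t)" for t
  define s where "s i = \<sigma> i i" for i
  have \<sigma>: "\<sigma> t i < N i" "Q t (\<sigma> t)" "brackets (val (\<sigma> t) (Suc t)) (scale (Suc t)) c" for t i
    using u[of t] unfolding good_def \<sigma>_def by (simp_all add: digit_less del: val_simps scale_simps)
  have \<sigma>_eq: "\<sigma> t i = s i" if "i \<le> t" for t i
    unfolding s_def
  proof (rule brackets_unique[of "\<sigma> t" "\<sigma> i" "Suc i" c])
    show "brackets (val (\<sigma> t) (Suc i)) (scale (Suc i)) c"
      using brackets_mono[of "\<sigma> t" "Suc i" "Suc t" c] \<sigma> that by blast
  qed (use \<sigma> in auto)
  show thesis
  proof (rule that[of s])
    show "s i < N i" for i unfolding s_def by (rule \<sigma>)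
    show "Q t s" for t using \<sigma>(2)[of t] cong[of t s "\<sigma> t"] \<sigma>_eq by simp
    show "brackets (val s t) (scale t) c" for t
    proof (cases t)
      case 0
      then show ?thesis using c by (auto simp: brackets_def code_set_def)
    next
      case (Suc m)
      have "val s (Suc m) = val (\<sigma> m) (Suc m)" using \<sigma>_eq[of _ m] by (intro val_cong) simp
      then show ?thesis using \<sigma>(3)[of m] by (simp only: Suc)
    qed
  qed
qed

text \<open>Position \<open>(t, j)\<close> of the enumeration deals with the ball around \<open>j / (2 * D)\<close> of radius
  \<open>1 / (2 * D)\<close>. It meets an interval \<open>[u, u + 1] / D\<close> iff \<open>u\<close> is \<open>j div 2\<close> or \<open>(j - 1) div 2\<close>.\<close>
definition gap_enum :: "(nat \<Rightarrow> (nat \<Rightarrow> nat) \<Rightarrow> bool) \<Rightarrow> nat \<Rightarrow> nat" where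
  "gap_enum Q n = (let t = fst (prod_decode n); j = snd (prod_decode n); D = scale (Suc t)
     in if j \<le> 2 * D \<and> \<not> good Q t (j div 2) \<and> \<not> good Q t ((j - 1) div 2)
        then Suc (prod_encode (prod_encode (2 * j, 2 * D - 1), prod_encode (2, 2 * D - 1)))
        else 0)"

lemma enum_union_gap_enum: "{0..1} - enum_union {0..1} dist unit_seq (gap_enum Q) = code_set Q"
proof -
  have ball: "c \<in> rball {0..1} dist unit_seq
      (prod_encode (prod_encode (2 * j, 2 * D - 1), prod_encode (2, 2 * D - 1)))
    \<longleftrightarrow> \<bar>2 * (c * real D) - real j\<bar> < 1" if "c \<in> {0..1}" "D > 0" "j \<le> 2 * D" for c j and D :: nat
  proof -
    have "rat_dec (prod_encode (2 * j, 2 * D - 1)) = real j / (2 * real D)"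
      using rat_dec_nonneg[of j "2 * D - 1"] that by simp
    moreover have "0 \<le> real j / (2 * real D)" "real j / (2 * real D) \<le> 1"
      using that by (simp_all add: divide_simps)
    ultimately have "unit_seq (prod_encode (2 * j, 2 * D - 1)) = real j / (2 * real D)"
      unfolding unit_seq_def by simp
    moreover have "rat_dec (prod_encode (2, 2 * D - 1)) = 1 / (2 * real D)"
      using rat_dec_nonneg[of 1 "2 * D - 1"] that by simp
    moreover have "dist (real j / (2 * real D)) c < 1 / (2 * real D) \<longleftrightarrow> \<bar>2 * (c * real D) - real j\<bar> < 1"
    proof -
      have "dist (real j / (2 * real D)) c = \<bar>(2 * (c * real D) - real j) / (2 * real D)\<bar>"
        unfolding dist_real_def abs_minus_commute[of _ c] using that by (simp add: field_simps)
      also have "\<dots> = \<bar>2 * (c * real D) - real j\<bar> / (2 * real D)" using that by (simp add: abs_divide)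
      finally show ?thesis using that by (simp add: divide_less_cancel)
    qed
    ultimately show ?thesis using that unfolding rball_def by simp
  qed
  have "c \<notin> enum_union {0..1} dist unit_seq (gap_enum Q) \<longleftrightarrow>
      (\<forall>t. \<exists>u. good Q t u \<and> brackets u (scale (Suc t)) c)" if c: "c \<in> {0..1}" for c
  proof
    assume out: "c \<notin> enum_union {0..1} dist unit_seq (gap_enum Q)"
    have key: "good Q t (j div 2) \<or> good Q t ((j - 1) div 2)"
      if "j \<le> 2 * scale (Suc t)" "\<bar>2 * (c * real (scale (Suc t))) - real j\<bar> < 1" for t j
    proof (rule ccontr)
      assume "\<not> ?thesis"
      then have "gap_enum Q (prod_encode (t, j)) = Suc (prod_encode (prod_encode (2 * j,
          2 * scale (Suc t) - 1), prod_encode (2, 2 * scale (Suc t) - 1)))"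
        using that(1) unfolding gap_enum_def Let_def by (simp del: scale_simps)
      then have "c \<in> enum_union {0..1} dist unit_seq (gap_enum Q)"
        unfolding enum_union_def using ball[OF c scale_pos that(1)] that(2)
        by (intro UN_I[of "prod_encode (t, j)"]) (simp_all del: scale_simps)
      with out show False by simp
    qed
    show "\<forall>t. \<exists>u. good Q t u \<and> brackets u (scale (Suc t)) c"
    proof
      fix t
      define D where "D = scale (Suc t)"
      define u where "u = nat \<lfloor>c * real D\<rfloor>"
      have nn: "0 \<le> c * real D" "c * real D \<le> real D"
        using c by (auto intro: mult_left_le_one_le)
      have u: "real u \<le> c * real D" "c * real D < real u + 1"
        using nn unfolding u_def by linarith+
      have "u \<le> D" using u(1) nn(2) by linarith
      show "\<exists>u. good Q t u \<and> brackets u (scale (Suc t)) c"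
      \<comment> \<open>Inside an interval, the ball around its midpoint meets no other interval. A
        grid point lies in the ball \<open>j = 2 * u\<close> only, which may meet two intervals, but
        then both contain \<open>c\<close>.\<close>
      proof (cases "c * real D = real u")
        case True
        have "good Q t u \<or> good Q t ((2 * u - 1) div 2)"
          using key[of "2 * u" t] True \<open>u \<le> D\<close> by (simp del: scale_simps add: D_def)
        then show ?thesis
        proof
          assume "good Q t u"
          then show ?thesis using True by (auto simp: brackets_def D_def simp del: scale_simps)
        next
          assume g: "good Q t ((2 * u - 1) div 2)"
          \<comment> \<open>At the left end, natural subtraction makes
            \<open>(2 * u - 1) div 2\<close> equal to \<open>u\<close> itself.\<close>
          have "brackets ((2 * u - 1) div 2) D c"
          proof (cases u)
            case 0
            then show ?thesis using True by (auto simp: brackets_def)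
          next
            case (Suc m)
            then have "(2 * u - 1) div 2 = m" by simp
            then show ?thesis using True Suc by (simp add: brackets_def)
          qed
          with g show ?thesis unfolding D_def by blast
        qed
      next
        case False
        with u have "real u < c * real D" by simp
        with nn(2) have "u < D" by linarith
        have "good Q t ((2 * u + 1) div 2) \<or> good Q t ((2 * u + 1 - 1) div 2)"
          by (rule key) (use \<open>real u < c * real D\<close> u \<open>u < D\<close> in \<open>auto simp: D_def[symmetric] abs_if simp del: scale_simps\<close>)
        then have "good Q t u" by simp
        then show ?thesis using u by (auto simp: brackets_def D_def simp del: scale_simps)
      qed
    qed
  next
    assume *: "\<forall>t. \<exists>u. good Q t u \<and> brackets u (scale (Suc t)) c"
    show "c \<notin> enum_union {0..1} dist unit_seq (gap_enum Q)"
    proof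
      assume "c \<in> enum_union {0..1} dist unit_seq (gap_enum Q)"
      then obtain n where n: "gap_enum Q n \<noteq> 0" "c \<in> rball {0..1} dist unit_seq (gap_enum Q n - 1)"
        unfolding enum_union_def by blast
      define t where "t = fst (prod_decode n)"
      define j where "j = snd (prod_decode n)"
      define D where "D = scale (Suc t)"
      have g: "j \<le> 2 * D" "\<not> good Q t (j div 2)" "\<not> good Q t ((j - 1) div 2)"
        and e: "gap_enum Q n = Suc (prod_encode (prod_encode (2 * j, 2 * D - 1), prod_encode (2, 2 * D - 1)))"
        using n(1) unfolding gap_enum_def Let_def t_def[symmetric] j_def[symmetric] D_def[symmetric]
        by (auto split: if_splits)
      have "D > 0" unfolding D_def by (rule scale_pos)
      with n(2) e ball[OF c _ g(1)] have j: "\<bar>2 * (c * real D) - real j\<bar> < 1" by simp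
      obtain u where u: "good Q t u" "brackets u D c" using * unfolding D_def by blast
      \<comment> \<open>Only three balls meet the interval of \<open>u\<close>, and for each of them
        one of the two tests in \<open>gap_enum\<close> asks about \<open>u\<close>.\<close>
      from u(2) j have "2 * real u - 1 < real j" "real j < 2 * real u + 3"
        unfolding brackets_def by linarith+
      then have "j = 2 * u \<or> j = 2 * u + 1 \<or> j = 2 * u + 2" by linarith
      then have "j div 2 = u \<or> (j - 1) div 2 = u" by auto
      with g u(1) show False by auto
    qed
  qed
  then show ?thesis unfolding code_set_def by auto
qed

end

section \<open>Computable metric spaces\<close>

lemma cauchy_limit_dist_le:
  assumes "Metric_space M d" "range \<alpha> \<subseteq> M" "cauchy_limit M d \<alpha> p x"
  shows "d (\<alpha> (p i)) x \<le> 1 / 2 ^ i"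
proof (rule field_le_epsilon)
  interpret Metric_space M d by fact
  fix e :: real assume "e > 0"
  then obtain K where K: "\<And>k. k \<ge> K \<Longrightarrow> d (\<alpha> (p k)) x < e" and "x \<in> M"
    and step: "\<And>i j. i < j \<Longrightarrow> d (\<alpha> (p i)) (\<alpha> (p j)) \<le> 1 / 2 ^ i"
    using assms(3) unfolding cauchy_limit_def by blast
  have "d (\<alpha> (p i)) x \<le> d (\<alpha> (p i)) (\<alpha> (p (max K (Suc i)))) + d (\<alpha> (p (max K (Suc i)))) x"
    using assms(2) \<open>x \<in> M\<close> by (intro triangle) auto
  also have "\<dots> \<le> 1 / 2 ^ i + e"
    using step[of i "max K (Suc i)"] K[of "max K (Suc i)"] by (intro add_mono) (simp_all add: less_max_iff_disj)
  finally show "d (\<alpha> (p i)) x \<le> 1 / 2 ^ i + e" .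
qed

lemma half_power_tail:
  fixes C e :: real
  assumes "e > 0"
  obtains T :: nat where "\<And>t. t \<ge> T \<Longrightarrow> C / 2 ^ t < e"
proof (cases "C > 0")
  case True
  with assms obtain T where T: "(1 / 2) ^ T < e / C"
    using real_arch_pow_inv[of "e / C" "1 / 2"] by auto
  have "C / 2 ^ t < e" if "t \<ge> T" for t
  proof -
    have "(1 / 2 :: real) ^ t \<le> (1 / 2) ^ T" using that by (intro power_decreasing) auto
    with T have "(1 / 2) ^ t < e / C" by linarith
    then show ?thesis using True by (simp add: field_simps power_divide)
  qed
  then show thesis by (rule that)
next
  case False
  then have "C / 2 ^ t \<le> 0" for t :: nat by (simp add: divide_nonpos_pos)
  with assms show thesis by (meson le_less_trans that)
qed

lemma cauchy_rep_eq_Some: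
  assumes "Metric_space M d" "range \<alpha> \<subseteq> M"
  shows "cauchy_rep M d \<alpha> p = Some x \<longleftrightarrow> cauchy_limit M d \<alpha> p x"
proof -
  interpret Metric_space M d by fact
  have unique: "y = z" if y: "cauchy_limit M d \<alpha> p y" and z: "cauchy_limit M d \<alpha> p z" for y z
  proof -
    have M: "y \<in> M" "z \<in> M" using y z unfolding cauchy_limit_def by auto
    have "d y z \<le> 0 + e" if "e > 0" for e
    proof -
      from that obtain T where T: "2 / 2 ^ T < e" using half_power_tail[of e 2] by blast
      have "d y z \<le> d y (\<alpha> (p T)) + d (\<alpha> (p T)) z"
        using assms(2) M by (intro triangle) auto
      moreover have "d y (\<alpha> (p T)) \<le> 1 / 2 ^ T"
        using cauchy_limit_dist_le[OF assms y, of T] by (simp only: commute)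
      ultimately show ?thesis using cauchy_limit_dist_le[OF assms z, of T] T by simp
    qed
    then have "d y z \<le> 0" by (rule field_le_epsilon)
    with M show ?thesis using nonneg[of y z] zero[of y z] by linarith
  qed
  show ?thesis
  proof
    assume "cauchy_rep M d \<alpha> p = Some x"
    then have "\<exists>y. cauchy_limit M d \<alpha> p y" "x = (THE y. cauchy_limit M d \<alpha> p y)"
      unfolding cauchy_rep_def by (auto split: if_splits)
    then show "cauchy_limit M d \<alpha> p x" using unique by (metis the_equality)
  next
    assume "cauchy_limit M d \<alpha> p x"
    moreover from this have "(THE y. cauchy_limit M d \<alpha> p y) = x" using unique by blast
    ultimately show "cauchy_rep M d \<alpha> p = Some x" unfolding cauchy_rep_def by auto
  qed
qed

section \<open>Rationals and distances in integer arithmetic\<close>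

definition rat_num :: "nat \<Rightarrow> nat" where
  "rat_num c = (if even (fst (prod_decode c)) then fst (prod_decode c) div 2 else 0)"

definition rat_den :: "nat \<Rightarrow> nat" where
  "rat_den c = Suc (snd (prod_decode c))"

lemma rat_den_pos: "rat_den c > 0"
  by (simp add: rat_den_def)

text \<open>Cutting negative rationals off at 0 keeps arithmetic in the naturals and loses nothing:
  approximations of distances only improve, and balls of negative radius are empty anyway.\<close>

lemma rat_num_den: "real (rat_num c) / real (rat_den c) = max 0 (rat_dec c)"
proof (cases "prod_decode c")
  case (Pair a b)
  show ?thesis
  proof (cases "even a")
    case True
    then have "int_decode a = int (a div 2)" by (simp add: int_decode_def sum_decode_def)
    then show ?thesis using Pair True by (simp add: rat_dec_def rat_num_def rat_den_def)
  next
    case False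
    then have "int_decode a \<le> 0" by (simp add: int_decode_def sum_decode_def)
    then have "rat_dec c \<le> 0" using Pair by (simp add: rat_dec_def divide_nonpos_pos)
    then show ?thesis using Pair False by (simp add: rat_num_def)
  qed
qed

lemma unit_seq_eq: "unit_seq c = real (min (rat_num c) (rat_den c)) / real (rat_den c)"
  unfolding unit_seq_def rat_num_den[symmetric] using rat_den_pos[of c]
  by (auto simp: min_def divide_simps)

definition dyadic_floor :: "nat \<Rightarrow> nat \<Rightarrow> nat" where
  "dyadic_floor c t = 2 ^ t * rat_num c div rat_den c"

lemma dyadic_floor_bounds:
  "real (dyadic_floor c t) \<le> 2 ^ t * max 0 (rat_dec c)"
  "2 ^ t * max 0 (rat_dec c) < real (dyadic_floor c t) + 1"
proof -
  have "2 ^ t * max 0 (rat_dec c) = real (2 ^ t * rat_num c) / real (rat_den c)"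
    by (simp add: rat_num_den[symmetric])
  moreover have "dyadic_floor c t = nat \<lfloor>real (2 ^ t * rat_num c) / real (rat_den c)\<rfloor>"
    unfolding dyadic_floor_def by (simp only: floor_divide_of_nat_eq nat_int)
  moreover have "0 \<le> real (2 ^ t * rat_num c) / real (rat_den c)" by simp
  ultimately show "real (dyadic_floor c t) \<le> 2 ^ t * max 0 (rat_dec c)"
    "2 ^ t * max 0 (rat_dec c) < real (dyadic_floor c t) + 1" by linarith+
qed

lemma env_comp_rat_num [env_intros]: "env_comp f \<Longrightarrow> env_comp (\<lambda>e. rat_num (f e))"
  unfolding rat_num_def by (intro env_intros)

lemma env_comp_rat_den [env_intros]: "env_comp f \<Longrightarrow> env_comp (\<lambda>e. rat_den (f e))"
  unfolding rat_den_def by (intro env_intros)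

lemma env_comp_dyadic_floor [env_intros]:
  "env_comp f \<Longrightarrow> env_comp g \<Longrightarrow> env_comp (\<lambda>e. dyadic_floor (f e) (g e))"
  unfolding dyadic_floor_def by (intro env_intros)

text \<open>Of the error 2, one unit is the precision \<open>1 / 2 ^ t\<close> of the given
  approximation, scaled by \<open>2 ^ t\<close>, and one comes from rounding down.\<close>

lemma dyadic_dist_approx:
  assumes "comp_metric_space M d \<alpha>"
  obtains D where "\<And>i j t. \<bar>real (D i j t) - 2 ^ t * d (\<alpha> i) (\<alpha> j)\<bar> \<le> 2"
    and "\<And>a b c. env_comp a \<Longrightarrow> env_comp b \<Longrightarrow> env_comp c \<Longrightarrow> env_comp (\<lambda>e. D (a e) (b e) (c e))"
proof -
  obtain \<phi> where \<phi>: "computable3 \<phi>" "\<And>i j n. \<bar>d (\<alpha> i) (\<alpha> j) - rat_dec (\<phi> i j n)\<bar> \<le> 1 / 2 ^ n"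
    and "Metric_space M d"
    using assms unfolding comp_metric_space_def by blast
  interpret Metric_space M d by fact
  have "\<bar>real (dyadic_floor (\<phi> i j t) t) - 2 ^ t * d (\<alpha> i) (\<alpha> j)\<bar> \<le> 2" for i j t
  proof -
    have "\<bar>d (\<alpha> i) (\<alpha> j) - max 0 (rat_dec (\<phi> i j t))\<bar> \<le> 1 / 2 ^ t"
      using \<phi>(2)[of i j t] nonneg[of "\<alpha> i" "\<alpha> j"] by linarith
    then have "2 ^ t * \<bar>d (\<alpha> i) (\<alpha> j) - max 0 (rat_dec (\<phi> i j t))\<bar> \<le> 1"
      by (simp add: mult.commute pos_le_divide_eq)
    then have "\<bar>2 ^ t * d (\<alpha> i) (\<alpha> j) - 2 ^ t * max 0 (rat_dec (\<phi> i j t))\<bar> \<le> 1"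
      by (simp add: right_diff_distrib[symmetric] abs_mult)
    then show ?thesis using dyadic_floor_bounds[where c = "\<phi> i j t" and t = t] by linarith
  qed
  moreover have "env_comp (\<lambda>e. dyadic_floor (\<phi> (a e) (b e) (c e)) (c e))"
    if "env_comp a" "env_comp b" "env_comp c" for a b c
    by (intro env_intros env_comp_of_computable3[OF \<phi>(1)] that)
  ultimately show thesis by (rule that)
qed

section \<open>Finite nets from co-c.e. compactness\<close>

lemma rball_dyadic:
  "rball M d \<alpha> (prod_encode (j, prod_encode (2, 2 ^ n - 1))) = {x \<in> M. d (\<alpha> j) x < 1 / 2 ^ n}"
proof -
  have "int_decode 2 = 1" by (simp add: int_decode_def sum_decode_def)
  then have "rat_dec (prod_encode (2, 2 ^ n - 1)) = 1 / 2 ^ n" by (simp add: rat_dec_def)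
  then show ?thesis by (simp add: rball_def)
qed

text \<open>The finite set of centres is enlarged to an initial segment of the dense sequence, so
  that a net is described by one number and can be searched for.\<close>

lemma ex_finite_net:
  fixes \<alpha> :: "nat \<Rightarrow> 'a"
  assumes d: "Metric_space M d" and cpt: "compact_space (Metric_space.mtopology M d)"
    and \<alpha>: "range \<alpha> \<subseteq> M" and dense: "\<And>x e. x \<in> M \<Longrightarrow> e > 0 \<Longrightarrow> \<exists>i. d (\<alpha> i) x < e"
    and e: "e > 0"
  shows "\<exists>k. M \<subseteq> (\<Union>j<k. {x \<in> M. d (\<alpha> j) x < e})"
proof -
  interpret Metric_space M d by fact
  have "compactin mtopology M" using cpt by (simp add: compact_space_def)
  moreover have "\<forall>U\<in>range (\<lambda>i. mball (\<alpha> i) e). openin mtopology U" by auto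
  moreover have "M \<subseteq> \<Union> (range (\<lambda>i. mball (\<alpha> i) e))"
    using \<alpha> dense[OF _ e] by (auto simp: in_mball image_subset_iff)
  ultimately obtain \<F> where \<F>: "finite \<F>" "\<F> \<subseteq> range (\<lambda>i. mball (\<alpha> i) e)" "M \<subseteq> \<Union> \<F>"
    unfolding compactin_def by meson
  then obtain I where I: "finite I" "\<F> = (\<lambda>i. mball (\<alpha> i) e) ` I"
    using finite_subset_image[of \<F> "\<lambda>i. mball (\<alpha> i) e" UNIV] by blast
  obtain k where "I \<subseteq> {..<k}" using finite_nat_iff_bounded[THEN iffD1, OF I(1)] by (rule exE)
  with \<F>(3) I(2) have "M \<subseteq> (\<Union>j<k. {x \<in> M. d (\<alpha> j) x < e})" by (fastforce simp: in_mball)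
  then show ?thesis ..
qed

lemma computable_nets:
  assumes M: "comp_metric_space M d \<alpha>" and cpt: "co_ce_compact M d \<alpha>"
  obtains N where "\<And>f. env_comp f \<Longrightarrow> env_comp (\<lambda>e. N (f e))" "\<And>n. N n > 0"
    "\<And>n x. x \<in> M \<Longrightarrow> \<exists>j<N n. d (\<alpha> j) x < 1 / 2 ^ n"
proof -
  define S where "S = {list_encode cs | cs. M \<subseteq> (\<Union>c \<in> set cs. rball M d \<alpha> c)}"
  obtain T where T: "computable2 T" "\<And>n. n \<in> S \<longleftrightarrow> (\<exists>t. T n t \<noteq> 0)"
    using cpt unfolding co_ce_compact_def S_def[symmetric] by (meson ce_set_staged)
  \<comment> \<open>This builds the code of a list of balls by primitive recursion; the list comes
    out reversed, which does not affect covering.\<close>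
  define enc where "enc n k = rec_nat 0
    (\<lambda>j y. Suc (prod_encode (prod_encode (j, prod_encode (2, 2 ^ n - 1)), y))) k" for n k
  have "enc n k = list_encode (rev (map (\<lambda>j. prod_encode (j, prod_encode (2, 2 ^ n - 1))) [0..<k]))" for n k
    by (induction k) (simp_all add: enc_def)
  then have S: "enc n k \<in> S \<longleftrightarrow> M \<subseteq> (\<Union>j<k. {x \<in> M. d (\<alpha> j) x < 1 / 2 ^ n})" for n k
    unfolding S_def by (auto simp: list_encode_eq rball_dyadic atLeast0LessThan simp del: One_nat_def)
  have ex: "\<exists>z. T (enc n (fst (prod_decode z))) (snd (prod_decode z)) \<noteq> 0" for n
  proof -
    obtain k where "enc n k \<in> S"
      using ex_finite_net[of M d \<alpha> "1 / 2 ^ n"] M cpt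
      unfolding S comp_metric_space_def co_ce_compact_def by auto
    then obtain t where "T (enc n k) t \<noteq> 0" using T(2) by blast
    then show ?thesis by (intro exI[of _ "prod_encode (k, t)"]) simp
  qed
  \<comment> \<open>Covering is only semidecidable, so the size of the net and the number of steps
    are searched for together, as one pair. The \<open>Suc\<close> in \<open>N\<close> gives
    positivity outright, and a larger net still covers.\<close>
  define Z where "Z n = (LEAST z. T (enc n (fst (prod_decode z))) (snd (prod_decode z)) \<noteq> 0)" for n
  define N where "N n = Suc (fst (prod_decode (Z n)))" for n
  show thesis
  proof (rule that[of N])
    show "env_comp (\<lambda>e. N (f e))" if "env_comp f" for f
    proof (rule env_comp_subst1[OF _ that])
      show "env_comp (\<lambda>e. N (e 0))" unfolding N_def Z_def enc_def
        by (intro env_intros env_comp_of_computable2[OF T(1)] ex[unfolded enc_def])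
    qed
    show "N n > 0" for n by (simp add: N_def)
    show "\<exists>j<N n. d (\<alpha> j) x < 1 / 2 ^ n" if "x \<in> M" for n x
    proof -
      have "T (enc n (fst (prod_decode (Z n)))) (snd (prod_decode (Z n))) \<noteq> 0"
        using LeastI_ex[OF ex[of n]] unfolding Z_def .
      then have "enc n (fst (prod_decode (Z n))) \<in> S" using T(2) by blast
      with that show ?thesis unfolding S N_def by (auto intro: less_SucI)
    qed
  qed
qed

text \<open>Both functionals of the reduction read one input entry, at a computed position, per
  output entry. The program answers 0 until the prefix contains that position, and afterwards always
  the same value.\<close>

lemma computable_pf_query:
  assumes g: "env_comp (\<lambda>e. g (e 0) (e (Suc 0)))" and u: "env_comp (\<lambda>e. u (e 0))"
  shows "computable_pf (\<lambda>p. Some (\<lambda>n. g (p (u n)) n))"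
proof -
  define tails where "tails c m = rec_nat c (\<lambda>_ z. snd (prod_decode (z - 1))) m" for c m
  define \<phi> where "\<phi> c n = (if tails c (u n) = 0 then 0
    else Suc (g (fst (prod_decode (tails c (u n) - 1))) n))" for c n
  have tails: "tails (list_encode xs) m = list_encode (drop m xs)" for xs m
  proof (induction m)
    case (Suc m)
    \<comment> \<open>The code 0 of the empty list is its own tail, so going past the end of the
      prefix stays at 0, which \<open>\<phi>\<close> reads as missing input.\<close>
    have "prod_decode 0 = (0, 0)" using prod_encode_inverse[of "(0, 0)"] by (simp add: prod_encode_def)
    then have "snd (prod_decode (list_encode ys - 1)) = list_encode (tl ys)" for ys
      by (cases ys) simp_all
    moreover have "tails (list_encode xs) (Suc m) = snd (prod_decode (tails (list_encode xs) m - 1))"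
      by (simp add: tails_def)
    ultimately show ?case using Suc by (simp add: drop_Suc tl_drop)
  qed (simp add: tails_def)
  have \<phi>: "\<phi> (prefix_code p k) n = (if u n < k then Suc (g (p (u n)) n) else 0)" for p k n
  proof (cases "u n < k")
    case True
    then have "drop (u n) (map p [0..<k]) = p (u n) # drop (Suc (u n)) (map p [0..<k])"
      by (subst Cons_nth_drop_Suc[symmetric]) simp_all
    then have "tails (prefix_code p k) (u n) =
       Suc (prod_encode (p (u n), list_encode (drop (Suc (u n)) (map p [0..<k]))))"
      by (simp only: prefix_code_def tails list_encode.simps)
    with True show ?thesis by (simp add: \<phi>_def)
  next
    case False
    then have "tails (prefix_code p k) (u n) = 0" by (simp add: prefix_code_def tails)
    with False show ?thesis by (simp add: \<phi>_def)
  qed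
  have "computable2 \<phi>" unfolding computable2_iff \<phi>_def tails_def
    by (intro env_intros env_comp_subst1[OF u] env_comp_subst2[OF g])
  moreover have "(\<exists>k. \<phi> (prefix_code p k) n = Suc (g (p (u n)) n)) \<and>
     (\<forall>k j. \<phi> (prefix_code p k) n = Suc j \<longrightarrow> j = g (p (u n)) n)" for p n
    unfolding \<phi> by (auto intro: exI[of _ "Suc (u n)"])
  ultimately show ?thesis unfolding computable_pf_def by auto
qed

section \<open>The reduction\<close>

locale computable_radix = mixed_radix +
  assumes env_comp_N: "env_comp f \<Longrightarrow> env_comp (\<lambda>e. N (f e))"
begin

lemma env_comp_scale: "env_comp f \<Longrightarrow> env_comp (\<lambda>e. scale (f e))"
  unfolding scale_def by (intro env_intros env_comp_N)

lemma env_comp_digit: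
  "env_comp f \<Longrightarrow> env_comp g \<Longrightarrow> env_comp h \<Longrightarrow> env_comp (\<lambda>e. digit (f e) (g e) (h e))"
  unfolding digit_def by (intro env_intros env_comp_N env_comp_scale)

text \<open>Variables range over numbers, so decidability of \<open>Q\<close> is stated for the
  digit sequences of numbers, the only sequences on which \<open>good\<close> evaluates it.\<close>

lemma env_dec_good:
  assumes Q: "env_dec (\<lambda>e. Q (e 0) (e (Suc 0)) (digit (Suc (e (Suc 0))) (e (Suc (Suc 0)))))"
    and x: "env_comp x" and t: "env_comp t" and u: "env_comp u"
  shows "env_dec (\<lambda>e. good (Q (x e)) (t e) (u e))"
proof -
  have "env_dec (\<lambda>e. good (Q (e 0)) (e (Suc 0)) (e (Suc (Suc 0))))"
    unfolding good_def val_def by (intro env_intros env_comp_N env_comp_digit Q)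
  then have "env_comp (\<lambda>e. if good (Q (e 0)) (e (Suc 0)) (e (Suc (Suc 0))) then 0 else 1)"
    unfolding env_dec_def .
  from env_comp_subst[OF this, of "case_nat x (case_nat t (\<lambda>_. u))"] x t u
  show ?thesis unfolding env_dec_def by (simp split: nat.split)
qed

lemma computable_pf_gap_enum:
  assumes Q: "env_dec (\<lambda>e. Q (e 0) (e (Suc 0)) (digit (Suc (e (Suc 0))) (e (Suc (Suc 0)))))"
  shows "computable_pf (\<lambda>p. Some (gap_enum (\<lambda>t. Q (p t) t)))"
proof -
  have "computable_pf (\<lambda>p. Some (\<lambda>n. gap_enum (Q (p (fst (prod_decode n)))) n))"
  proof (rule computable_pf_query)
    show "env_comp (\<lambda>e. gap_enum (Q (e 0)) (e (Suc 0)))"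
      unfolding gap_enum_def Let_def by (intro env_intros env_comp_scale env_dec_good[OF Q])
  qed (intro env_intros)
  \<comment> \<open>Position \<open>n\<close> involves the predicate at the single stage coded in
    \<open>n\<close>, so the entry of \<open>p\<close> may be frozen at that stage and one query
    suffices.\<close>
  moreover have "(\<lambda>n. gap_enum (Q (p (fst (prod_decode n)))) n) = gap_enum (\<lambda>t. Q (p t) t)" for p
    by (auto simp: gap_enum_def good_def Let_def fun_eq_iff)
  ultimately show ?thesis by simp
qed

definition read_digit :: "nat \<Rightarrow> nat \<Rightarrow> nat" where
  "read_digit c i = ((2 * min (rat_num c) (rat_den c) * scale (Suc i) + rat_den c) div (2 * rat_den c))
     mod (2 * N i) div 2"

lemma read_digit:
  assumes "s i < N i" "brackets (val s (Suc i)) (scale (Suc i)) c"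
    and "\<bar>unit_seq r - c\<bar> \<le> 1 / 2 ^ (2 * scale (Suc i))"
  shows "read_digit r i = s i"
  unfolding read_digit_def
proof (rule digit_of_approx[OF assms(1,2) rat_den_pos])
  \<comment> \<open>An error below \<open>1 / (2 * scale (Suc i))\<close> is required. By
    \<open>m < 2 ^ m\<close> the index \<open>2 * scale (Suc i)\<close> is late enough, with no
    logarithm to compute.\<close>
  have "2 * real (scale (Suc i)) < 2 ^ (2 * scale (Suc i))"
    by (metis of_nat_less_two_power of_nat_mult of_nat_numeral)
  then have "1 / 2 ^ (2 * scale (Suc i)) * (2 * real (scale (Suc i))) < 1"
    by (simp add: divide_simps del: scale_simps)
  moreover have "\<bar>unit_seq r - c\<bar> * (2 * real (scale (Suc i)))
      \<le> 1 / 2 ^ (2 * scale (Suc i)) * (2 * real (scale (Suc i)))"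
    using assms(3) by (rule mult_right_mono) simp
  ultimately show "\<bar>real (min (rat_num r) (rat_den r)) / real (rat_den r) - c\<bar> * (2 * real (scale (Suc i))) < 1"
    unfolding unit_seq_eq by linarith
qed

text \<open>\<open>bpair p q\<close> holds \<open>q m\<close> at position \<open>Suc (2 * m)\<close>. The shift by one place in the output turns
  distances \<open>1 / 2 ^ i + 1 / 2 ^ j\<close> into the modulus \<open>1 / 2 ^ i\<close> of Cauchy names.\<close>
definition decoder :: "baire \<Rightarrow> baire" where
  "decoder z n = read_digit (z (Suc (2 * (2 * scale (Suc (Suc n)))))) (Suc n)"

lemma computable_pf_decoder: "computable_pf (\<lambda>z. Some (decoder z))"
proof -
  have "computable_pf (\<lambda>z. Some (\<lambda>n. read_digit (z (Suc (2 * (2 * scale (Suc (Suc n)))))) (Suc n)))"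
  proof (rule computable_pf_query)
    show "env_comp (\<lambda>e. read_digit (e 0) (Suc (e (Suc 0))))"
      unfolding read_digit_def by (intro env_intros env_comp_N env_comp_scale)
  qed (intro env_intros env_comp_scale)
  then show ?thesis unfolding decoder_def .
qed

lemma decoder_eq:
  assumes s: "\<And>i. s i < N i" and c: "\<And>t. brackets (val s t) (scale t) c"
    and q: "delta_R q = Some c"
  shows "decoder (bpair p q) = (\<lambda>n. s (Suc n))"
proof
  fix n
  have M: "Metric_space {0..1::real} dist"
    by unfold_locales (auto simp: dist_commute dist_triangle)
  have unit: "range unit_seq \<subseteq> {0..1}" by (auto simp: unit_seq_def)
  from q have "cauchy_limit {0..1} dist unit_seq q c" by (simp only: cauchy_rep_eq_Some[OF M unit])
  from cauchy_limit_dist_le[OF M unit this]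
  have "\<bar>unit_seq (q m) - c\<bar> \<le> 1 / 2 ^ m" for m by (simp add: dist_real_def)
  then have "read_digit (q (2 * scale (Suc (Suc n)))) (Suc n) = s (Suc n)"
    by (rule read_digit[OF s c])
  then show "decoder (bpair p q) n = s (Suc n)"
    by (simp add: decoder_def bpair_def del: scale_simps)
qed

end

text \<open>Here \<open>x\<close> is the \<open>t\<close>-th entry of a Cauchy name, \<open>s\<close> lists centres of balls of radii \<open>2\<^sup>-\<^sup>i\<close>
  around a candidate point, and \<open>DX\<close>, \<open>DY\<close> are integer approximations of \<open>2\<^sup>t\<close> times the distances,
  with error at most 2; the additive constants absorb these errors.\<close>
definition consistent ::
  "(nat \<Rightarrow> nat \<Rightarrow> nat \<Rightarrow> nat) \<Rightarrow> (nat \<Rightarrow> nat \<Rightarrow> nat \<Rightarrow> nat) \<Rightarrow> baire \<Rightarrow> nat \<Rightarrow> nat \<Rightarrow> (nat \<Rightarrow> nat) \<Rightarrow> bool" where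
  "consistent DX DY a x t s \<longleftrightarrow>
     (\<forall>i<Suc t. \<forall>k<Suc t. DY (s i) (s k) t \<le> 2 ^ (t - i) + 2 ^ (t - k) + 2) \<and>
     (\<forall>n<t. a n \<noteq> 0 \<longrightarrow>
        \<not> (DX (fst (prod_decode (fst (prod_decode (a n - 1))))) x t + 3
             < dyadic_floor (snd (prod_decode (a n - 1))) t \<and>
           DY (snd (prod_decode (fst (prod_decode (a n - 1))))) (s t) t + 3
             < dyadic_floor (snd (prod_decode (a n - 1))) t))"

lemma consistent_cong:
  "(\<And>i. i \<le> t \<Longrightarrow> s i = s' i) \<Longrightarrow> consistent DX DY a x t s = consistent DX DY a x t s'"
  unfolding consistent_def by (simp add: less_Suc_eq_le)

lemma rball_prod_iff:
  "(x, y) \<in> rball (MX \<times> MY) (max_prod_dist dX dY) (prod_seq \<alpha>X \<alpha>Y) c \<longleftrightarrow>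
     x \<in> MX \<and> y \<in> MY \<and>
     dX (\<alpha>X (fst (prod_decode (fst (prod_decode c))))) x < rat_dec (snd (prod_decode c)) \<and>
     dY (\<alpha>Y (snd (prod_decode (fst (prod_decode c))))) y < rat_dec (snd (prod_decode c))"
  by (auto simp: rball_def max_prod_dist_def prod_seq_def split: prod.splits)

text \<open>The slack in each test covers all approximation errors, so a stage rejects only what is
  certainly wrong; centres describing an actual point of the fibre pass.\<close>

lemma consistentI:
  assumes MX: "Metric_space MX dX" "range \<alpha>X \<subseteq> MX" and MY: "Metric_space MY dY" "range \<alpha>Y \<subseteq> MY"
    and DX: "\<And>i j t. \<bar>real (DX i j t) - 2 ^ t * dX (\<alpha>X i) (\<alpha>X j)\<bar> \<le> 2"
    and DY: "\<And>i j t. \<bar>real (DY i j t) - 2 ^ t * dY (\<alpha>Y i) (\<alpha>Y j)\<bar> \<le> 2"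
    and xy: "x \<in> MX" "y \<in> MY"
    and out: "(x, y) \<notin> enum_union (MX \<times> MY) (max_prod_dist dX dY) (prod_seq \<alpha>X \<alpha>Y) a"
    and x: "dX (\<alpha>X z) x \<le> 1 / 2 ^ t" and y: "\<And>i. dY (\<alpha>Y (s i)) y \<le> 1 / 2 ^ i"
  shows "consistent DX DY a z t s"
proof -
  interpret X: Metric_space MX dX by fact
  interpret Y: Metric_space MY dY by fact
  \<comment> \<open>The 3 in the test consists of 2 for the error of \<open>D\<close> and 1 for the
    scaled distance from the centre \<open>\<alpha> v\<close> to \<open>w\<close>.\<close>
  have near: "d (\<alpha> c) w < rat_dec r"
    if "Metric_space M d" "range \<alpha> \<subseteq> M" "w \<in> M" "\<bar>real (D c v t) - 2 ^ t * d (\<alpha> c) (\<alpha> v)\<bar> \<le> 2"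
      "d (\<alpha> v) w \<le> 1 / 2 ^ t" "D c v t + 3 < dyadic_floor r t"
    for M :: "'c set" and d and \<alpha> :: "nat \<Rightarrow> 'c" and w D c v r
  proof -
    interpret Metric_space M d by fact
    have "d (\<alpha> c) w \<le> d (\<alpha> c) (\<alpha> v) + d (\<alpha> v) w" using that by (intro triangle) auto
    with that(5) have "d (\<alpha> c) w \<le> d (\<alpha> c) (\<alpha> v) + 1 / 2 ^ t" by linarith
    then have "2 ^ t * d (\<alpha> c) w \<le> 2 ^ t * (d (\<alpha> c) (\<alpha> v) + 1 / 2 ^ t)"
      by (rule mult_left_mono) simp
    then have "2 ^ t * d (\<alpha> c) w \<le> 2 ^ t * d (\<alpha> c) (\<alpha> v) + 1" by (simp add: distrib_left)
    moreover have "real (D c v t) + 3 < real (dyadic_floor r t)" using that(6) by linarith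
    ultimately have "2 ^ t * d (\<alpha> c) w < 2 ^ t * max 0 (rat_dec r)"
      using that(4) dyadic_floor_bounds(1)[of r t] by linarith
    then have "d (\<alpha> c) w < max 0 (rat_dec r)" by simp
    with nonneg[of "\<alpha> c" w] show ?thesis by linarith
  qed
  have "DY (s i) (s k) t \<le> 2 ^ (t - i) + 2 ^ (t - k) + 2" if "i \<le> t" "k \<le> t" for i k
  proof -
    have "dY (\<alpha>Y (s i)) (\<alpha>Y (s k)) \<le> dY (\<alpha>Y (s i)) y + dY y (\<alpha>Y (s k))"
      using MY xy by (intro Y.triangle) auto
    also have "\<dots> \<le> 1 / 2 ^ i + 1 / 2 ^ k"
      using y[of i] y[of k] unfolding Y.commute[of y] by linarith
    finally have "2 ^ t * dY (\<alpha>Y (s i)) (\<alpha>Y (s k)) \<le> 2 ^ t * (1 / 2 ^ i + 1 / 2 ^ k)"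
      by (rule mult_left_mono) simp
    also have "\<dots> = 2 ^ (t - i) + 2 ^ (t - k)"
      using that by (simp add: distrib_left power_diff)
    finally have "real (DY (s i) (s k) t) \<le> 2 ^ (t - i) + 2 ^ (t - k) + 2"
      using DY[of "s i" "s k" t] by linarith
    also have "\<dots> = real (2 ^ (t - i) + 2 ^ (t - k) + 2)" by simp
    finally show ?thesis by (simp only: of_nat_le_iff)
  qed
  moreover have False
    if "a n \<noteq> 0" "DX (fst (prod_decode (fst (prod_decode (a n - 1))))) z t + 3
          < dyadic_floor (snd (prod_decode (a n - 1))) t"
      "DY (snd (prod_decode (fst (prod_decode (a n - 1))))) (s t) t + 3
          < dyadic_floor (snd (prod_decode (a n - 1))) t" for n
  proof -
    have "(x, y) \<in> rball (MX \<times> MY) (max_prod_dist dX dY) (prod_seq \<alpha>X \<alpha>Y) (a n - 1)"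
      unfolding rball_prod_iff
      using near[of MX dX \<alpha>X x DX, OF MX xy(1) DX x that(2)]
        near[of MY dY \<alpha>Y y DY, OF MY xy(2) DY y that(3)] xy by blast
    with out that(1) show False unfolding enum_union_def by blast
  qed
  ultimately show ?thesis unfolding consistent_def by (auto simp: less_Suc_eq_le)
qed

text \<open>A single stage proves little, but its errors are constant only after scaling by
  \<open>2 ^ t\<close>. Their true size tends to 0, so passing all stages forces the exact
  inequalities.\<close>

lemma consistent_limit:
  assumes MX: "Metric_space MX dX" "range \<alpha>X \<subseteq> MX" and MY: "Metric_space MY dY" "range \<alpha>Y \<subseteq> MY"
    and compl: "Metric_space.mcomplete MY dY"
    and DX: "\<And>i j t. \<bar>real (DX i j t) - 2 ^ t * dX (\<alpha>X i) (\<alpha>X j)\<bar> \<le> 2"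
    and DY: "\<And>i j t. \<bar>real (DY i j t) - 2 ^ t * dY (\<alpha>Y i) (\<alpha>Y j)\<bar> \<le> 2"
    and x: "x \<in> MX" "\<And>t. dX (\<alpha>X (p t)) x \<le> 1 / 2 ^ t"
    and s: "\<And>t. consistent DX DY a (p t) t s"
  obtains y where "cauchy_limit MY dY \<alpha>Y (\<lambda>n. s (Suc n)) y"
    "(x, y) \<notin> enum_union (MX \<times> MY) (max_prod_dist dX dY) (prod_seq \<alpha>X \<alpha>Y) a"
proof -
  interpret X: Metric_space MX dX by fact
  interpret Y: Metric_space MY dY by fact
  have step: "dY (\<alpha>Y (s i)) (\<alpha>Y (s k)) \<le> 1 / 2 ^ i + 1 / 2 ^ k" for i k
  proof (rule field_le_epsilon)
    fix e :: real assume "e > 0"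
    \<comment> \<open>The 4 adds the slack 2 of the test and the error 2 of
      \<open>DY\<close>.\<close>
    then obtain T where T: "\<And>t. t \<ge> T \<Longrightarrow> 4 / 2 ^ t < e" using half_power_tail[of e 4] by blast
    define t where "t = max T (max i k)"
    then have t: "T \<le> t" "i \<le> t" "k \<le> t" by simp_all
    have "DY (s i) (s k) t \<le> 2 ^ (t - i) + 2 ^ (t - k) + 2"
      using s[of t] t unfolding consistent_def by (simp add: less_Suc_eq_le)
    then have "real (DY (s i) (s k) t) \<le> real (2 ^ (t - i) + 2 ^ (t - k) + 2)"
      by (simp only: of_nat_le_iff)
    also have "\<dots> = 2 ^ (t - i) + 2 ^ (t - k) + 2" by simp
    also have "\<dots> = 2 ^ t * (1 / 2 ^ i + 1 / 2 ^ k) + 2"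
      using t by (simp add: distrib_left power_diff)
    finally have "2 ^ t * dY (\<alpha>Y (s i)) (\<alpha>Y (s k)) \<le> 2 ^ t * (1 / 2 ^ i + 1 / 2 ^ k) + 4"
      using DY[of "s i" "s k" t] by linarith
    also have "\<dots> = 2 ^ t * (1 / 2 ^ i + 1 / 2 ^ k + 4 / 2 ^ t)" by (simp add: distrib_left)
    finally have "dY (\<alpha>Y (s i)) (\<alpha>Y (s k)) \<le> 1 / 2 ^ i + 1 / 2 ^ k + 4 / 2 ^ t" by simp
    with T[OF t(1)] show "dY (\<alpha>Y (s i)) (\<alpha>Y (s k)) \<le> 1 / 2 ^ i + 1 / 2 ^ k + e" by linarith
  qed
  have "Y.MCauchy (\<lambda>i. \<alpha>Y (s i))"
    unfolding Y.MCauchy_def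
  proof (intro conjI allI impI)
    show "range (\<lambda>i. \<alpha>Y (s i)) \<subseteq> MY" using MY by auto
    fix e :: real assume "e > 0"
    then obtain T where T: "\<And>t. t \<ge> T \<Longrightarrow> 1 / 2 ^ t < e / 2" using half_power_tail[of "e / 2" 1] by auto
    have "dY (\<alpha>Y (s i)) (\<alpha>Y (s k)) < e" if "T \<le> i" "T \<le> k" for i k
      using step[of i k] T[OF that(1)] T[OF that(2)] by linarith
    then show "\<exists>T. \<forall>i k. T \<le> i \<longrightarrow> T \<le> k \<longrightarrow> dY (\<alpha>Y (s i)) (\<alpha>Y (s k)) < e" by blast
  qed
  then obtain y where lim: "limitin Y.mtopology (\<lambda>i. \<alpha>Y (s i)) y sequentially"
    using compl unfolding Y.mcomplete_def by blast
  then have y: "y \<in> MY" and tail: "\<And>e. e > 0 \<Longrightarrow> \<exists>T. \<forall>i\<ge>T. dY (\<alpha>Y (s i)) y < e"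
    unfolding Y.limit_metric_sequentially by blast+
  have near: "dY (\<alpha>Y (s i)) y \<le> 1 / 2 ^ i" for i
  proof (rule field_le_epsilon)
    fix e :: real assume "e > 0"
    then obtain T where T: "\<And>t. t \<ge> T \<Longrightarrow> 1 / 2 ^ t < e / 2" using half_power_tail[of "e / 2" 1] by auto
    obtain T' where T': "\<And>k. k \<ge> T' \<Longrightarrow> dY (\<alpha>Y (s k)) y < e / 2" using tail[of "e / 2"] \<open>e > 0\<close> by auto
    define k where "k = max T T'"
    have "dY (\<alpha>Y (s i)) y \<le> dY (\<alpha>Y (s i)) (\<alpha>Y (s k)) + dY (\<alpha>Y (s k)) y"
      using MY y by (intro Y.triangle) auto
    moreover have "1 / 2 ^ k < e / 2" "dY (\<alpha>Y (s k)) y < e / 2"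
      unfolding k_def by (rule T T', simp)+
    ultimately show "dY (\<alpha>Y (s i)) y \<le> 1 / 2 ^ i + e"
      using step[of i k] by linarith
  qed
  show thesis
  proof (rule that)
    show "cauchy_limit MY dY \<alpha>Y (\<lambda>n. s (Suc n)) y"
      unfolding cauchy_limit_def
    proof (intro conjI allI impI y)
      fix i j :: nat assume "i < j"
      then have "(1 / 2 :: real) ^ Suc j \<le> (1 / 2) ^ Suc i" by (intro power_decreasing) auto
      then have "1 / 2 ^ Suc i + 1 / 2 ^ Suc j \<le> (1 :: real) / 2 ^ i" by (simp add: power_divide)
      with step[of "Suc i" "Suc j"]
      show "dY (\<alpha>Y (s (Suc i))) (\<alpha>Y (s (Suc j))) \<le> 1 / 2 ^ i" by linarith
    next
      fix e :: real assume "e > 0"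
      then obtain T where "\<And>i. i \<ge> T \<Longrightarrow> dY (\<alpha>Y (s i)) y < e" using tail by blast
      then show "\<exists>T. \<forall>i\<ge>T. dY (\<alpha>Y (s (Suc i))) y < e" by (intro exI[of _ T]) auto
    qed
    show "(x, y) \<notin> enum_union (MX \<times> MY) (max_prod_dist dX dY) (prod_seq \<alpha>X \<alpha>Y) a"
    proof
      assume "(x, y) \<in> enum_union (MX \<times> MY) (max_prod_dist dX dY) (prod_seq \<alpha>X \<alpha>Y) a"
      then obtain n where n: "a n \<noteq> 0"
        "(x, y) \<in> rball (MX \<times> MY) (max_prod_dist dX dY) (prod_seq \<alpha>X \<alpha>Y) (a n - 1)"
        unfolding enum_union_def by blast
      define cX where "cX = fst (prod_decode (fst (prod_decode (a n - 1))))"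
      define cY where "cY = snd (prod_decode (fst (prod_decode (a n - 1))))"
      define r where "r = snd (prod_decode (a n - 1))"
      have lt: "dX (\<alpha>X cX) x < rat_dec r" "dY (\<alpha>Y cY) y < rat_dec r"
        using n(2) unfolding rball_prod_iff cX_def cY_def r_def by auto
      \<comment> \<open>7 = 2 + 1 + 3 + 1: error of the distance, scaled distance of the
        approximating centre, margin of the test, and rounding down of the radius.\<close>
      obtain T1 where T1: "\<And>t. t \<ge> T1 \<Longrightarrow> 7 / 2 ^ t < rat_dec r - dX (\<alpha>X cX) x"
        using half_power_tail[of "rat_dec r - dX (\<alpha>X cX) x" 7] lt by auto
      obtain T2 where T2: "\<And>t. t \<ge> T2 \<Longrightarrow> 7 / 2 ^ t < rat_dec r - dY (\<alpha>Y cY) y"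
        using half_power_tail[of "rat_dec r - dY (\<alpha>Y cY) y" 7] lt by auto
      \<comment> \<open>Stage \<open>t\<close> inspects only the balls with index below
        \<open>t\<close>, so \<open>t\<close> has to exceed \<open>n\<close>.\<close>
      define t where "t = Suc (max n (max T1 T2))"
      have t: "n < t" "T1 \<le> t" "T2 \<le> t" by (auto simp: t_def)
      have detect: "D c v t + 3 < dyadic_floor r t"
        if "Metric_space M d" "range \<alpha> \<subseteq> M" "w \<in> M" "\<bar>real (D c v t) - 2 ^ t * d (\<alpha> c) (\<alpha> v)\<bar> \<le> 2"
          "d (\<alpha> v) w \<le> 1 / 2 ^ t" "7 / 2 ^ t < rat_dec r - d (\<alpha> c) w"
        for M :: "'c set" and d and \<alpha> :: "nat \<Rightarrow> 'c" and w D c v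
      proof -
        interpret Metric_space M d by fact
        have "d (\<alpha> c) (\<alpha> v) \<le> d (\<alpha> c) w + d w (\<alpha> v)" using that by (intro triangle) auto
        with that(5) have "d (\<alpha> c) (\<alpha> v) \<le> d (\<alpha> c) w + 1 / 2 ^ t" unfolding commute[of w] by linarith
        then have "2 ^ t * d (\<alpha> c) (\<alpha> v) \<le> 2 ^ t * (d (\<alpha> c) w + 1 / 2 ^ t)"
          by (rule mult_left_mono) simp
        then have "2 ^ t * d (\<alpha> c) (\<alpha> v) \<le> 2 ^ t * d (\<alpha> c) w + 1" by (simp add: distrib_left)
        moreover have "2 ^ t * (7 / 2 ^ t) < 2 ^ t * (rat_dec r - d (\<alpha> c) w)"
          using that(6) by (rule mult_strict_left_mono) simp
        then have "7 < 2 ^ t * rat_dec r - 2 ^ t * d (\<alpha> c) w" by (simp add: right_diff_distrib)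
        moreover have "2 ^ t * rat_dec r \<le> 2 ^ t * max 0 (rat_dec r)" by simp
        ultimately have "real (D c v t) + 3 < real (dyadic_floor r t)"
          using that(4) dyadic_floor_bounds(2)[where c = r and t = t] by linarith
        then show ?thesis by linarith
      qed
      have "DX cX (p t) t + 3 < dyadic_floor r t"
        by (rule detect[of MX dX \<alpha>X x DX, OF MX x(1) DX x(2) T1[OF t(2)]])
      moreover have "DY cY (s t) t + 3 < dyadic_floor r t"
        by (rule detect[of MY dY \<alpha>Y y DY, OF MY y DY near T2[OF t(3)]])
      ultimately show False
        using s[of t] n(1) t(1) unfolding consistent_def cX_def cY_def r_def by blast
    qed
  qed
qed

theorem theorem8p5:
  fixes MX :: "'a set" and dX :: "'a \<Rightarrow> 'a \<Rightarrow> real" and \<alpha>X :: "nat \<Rightarrow> 'a"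
    and MY :: "'b set" and dY :: "'b \<Rightarrow> 'b \<Rightarrow> real" and \<alpha>Y :: "nat \<Rightarrow> 'b"
    and A :: "('a \<times> 'b) set"
  assumes X: "comp_metric_space MX dX \<alpha>X"
    and Y: "comp_metric_space MY dY \<alpha>Y"
    and Ycpt: "co_ce_compact MY dY \<alpha>Y"
    and Acl: "co_ce_closed (MX \<times> MY) (max_prod_dist dX dY) (prod_seq \<alpha>X \<alpha>Y) A"
    and tot: "\<forall>x\<in>MX. \<exists>y\<in>MY. (x, y) \<in> A"
  shows "weihrauch_le (cauchy_rep MX dX \<alpha>X) (cauchy_rep MY dY \<alpha>Y) (\<lambda>x. {y \<in> MY. (x, y) \<in> A})
           delta_CK delta_R CK"
proof -
  have MX: "Metric_space MX dX" "range \<alpha>X \<subseteq> MX" and MY: "Metric_space MY dY" "range \<alpha>Y \<subseteq> MY"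
    using X Y unfolding comp_metric_space_def by auto
  interpret Y: Metric_space MY dY by (rule MY)
  \<comment> \<open>Completeness makes the centres named by a decoded sequence converge.\<close>
  have compl: "Y.mcomplete"
    using Ycpt Y.compact_space_imp_mcomplete unfolding co_ce_compact_def by blast
  obtain DX where DX: "\<And>i j t. \<bar>real (DX i j t) - 2 ^ t * dX (\<alpha>X i) (\<alpha>X j)\<bar> \<le> 2"
    and env_comp_DX: "\<And>a b c. env_comp a \<Longrightarrow> env_comp b \<Longrightarrow> env_comp c \<Longrightarrow> env_comp (\<lambda>e. DX (a e) (b e) (c e))"
    using dyadic_dist_approx[OF X] by metis
  obtain DY where DY: "\<And>i j t. \<bar>real (DY i j t) - 2 ^ t * dY (\<alpha>Y i) (\<alpha>Y j)\<bar> \<le> 2"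
    and env_comp_DY: "\<And>a b c. env_comp a \<Longrightarrow> env_comp b \<Longrightarrow> env_comp c \<Longrightarrow> env_comp (\<lambda>e. DY (a e) (b e) (c e))"
    using dyadic_dist_approx[OF Y] by metis
  obtain N where N: "\<And>f. env_comp f \<Longrightarrow> env_comp (\<lambda>e. N (f e))" "\<And>n. N n > 0"
    "\<And>n y. y \<in> MY \<Longrightarrow> \<exists>j<N n. dY (\<alpha>Y j) y < 1 / 2 ^ n"
    using computable_nets[OF Y Ycpt] by metis
  interpret computable_radix N using N by unfold_locales
  obtain a where a: "computable1 a"
    and A: "A = MX \<times> MY - enum_union (MX \<times> MY) (max_prod_dist dX dY) (prod_seq \<alpha>X \<alpha>Y) a"
    using Acl unfolding co_ce_closed_def closed_neg_rep_def by auto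
  define Q where "Q = consistent DX DY a"
  have Q_cong: "Q x t s = Q x t s'" if "\<And>i. i \<le> t \<Longrightarrow> s i = s' i" for x t s s'
    unfolding Q_def using that by (rule consistent_cong)
  have "env_dec (\<lambda>e. Q (e 0) (e (Suc 0)) (digit (Suc (e (Suc 0))) (e (Suc (Suc 0)))))"
    unfolding Q_def consistent_def
    by (intro env_intros env_comp_DX env_comp_DY env_comp_digit env_comp_of_computable1[OF a])
  then have K: "computable_pf (\<lambda>p. Some (gap_enum (\<lambda>t. Q (p t) t)))"
    by (rule computable_pf_gap_enum)
  have "realizer (cauchy_rep MX dX \<alpha>X) (cauchy_rep MY dY \<alpha>Y) (\<lambda>x. {y \<in> MY. (x, y) \<in> A})
      (\<lambda>p. case Some (gap_enum (\<lambda>t. Q (p t) t)) of None \<Rightarrow> None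
           | Some k \<Rightarrow> (case G k of None \<Rightarrow> None | Some r \<Rightarrow> Some (decoder (bpair p r))))"
    if G: "realizer delta_CK delta_R CK G" for G
    unfolding realizer_def
  proof (intro allI impI)
    fix p x assume "cauchy_rep MX dX \<alpha>X p = Some x"
    then have p: "cauchy_limit MX dX \<alpha>X p x" by (simp only: cauchy_rep_eq_Some[OF MX])
    then have x: "x \<in> MX" by (simp add: cauchy_limit_def)
    note near_x = cauchy_limit_dist_le[OF MX p]
    define C where "C = code_set (\<lambda>t. Q (p t) t)"
    \<comment> \<open>This \<open>y\<close> only shows that \<open>C\<close> is non-empty. The
      realizer of choice may return the code of another point, the \<open>y'\<close> below.\<close>
    obtain y where y: "y \<in> MY" "(x, y) \<in> A" using tot x by blast
    obtain s where s: "\<And>n. s n < N n" "\<And>n. dY (\<alpha>Y (s n)) y < 1 / 2 ^ n"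
      using N(3)[OF y(1)] by metis
    have Qs: "Q (p t) t s" for t
      unfolding Q_def using y s(2) A
      by (intro consistentI[OF MX MY DX DY x y(1) _ near_x]) (auto intro: less_imp_le)
    have "C \<noteq> {}" unfolding C_def
      by (rule code_set_nonempty[of s "\<lambda>t. Q (p t) t", OF s(1) Qs]) (rule Q_cong)
    moreover have "delta_CK (gap_enum (\<lambda>t. Q (p t) t)) = Some C"
      by (simp add: closed_neg_rep_def enum_union_gap_enum C_def)
    ultimately obtain q c where q: "G (gap_enum (\<lambda>t. Q (p t) t)) = Some q" "delta_R q = Some c" "c \<in> C"
      using G unfolding realizer_def CK_def by blast
    from q(3) obtain s' where s': "\<And>i. s' i < N i" "\<And>t. Q (p t) t s'"
      "\<And>t. brackets (val s' t) (scale t) c"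
      unfolding C_def by (rule code_setD[where Q = "\<lambda>t. Q (p t) t"]) (rule Q_cong, blast+)
    obtain y' where y': "cauchy_limit MY dY \<alpha>Y (\<lambda>n. s' (Suc n)) y'"
      "(x, y') \<notin> enum_union (MX \<times> MY) (max_prod_dist dX dY) (prod_seq \<alpha>X \<alpha>Y) a"
      using consistent_limit[OF MX MY compl DX DY x near_x s'(2)[unfolded Q_def]] by blast
    have "decoder (bpair p q) = (\<lambda>n. s' (Suc n))" using s'(1,3) q(2) by (rule decoder_eq)
    moreover have "cauchy_rep MY dY \<alpha>Y (\<lambda>n. s' (Suc n)) = Some y'"
      using y'(1) by (simp only: cauchy_rep_eq_Some[OF MY])
    moreover have "y' \<in> {y \<in> MY. (x, y) \<in> A}" using y' x unfolding A cauchy_limit_def by blast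
    ultimately show "\<exists>q y. (case Some (gap_enum (\<lambda>t. Q (p t) t)) of None \<Rightarrow> None
           | Some k \<Rightarrow> (case G k of None \<Rightarrow> None | Some r \<Rightarrow> Some (decoder (bpair p r)))) = Some q \<and>
        cauchy_rep MY dY \<alpha>Y q = Some y \<and> y \<in> {y \<in> MY. (x, y) \<in> A}"
      using q(1) by simp
  qed
  then show ?thesis
    unfolding weihrauch_le_def using K computable_pf_decoder by blast
qed

end
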